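(* Let $A$ be a finite totally ordered set and let $\mathbb{K}$ be a field of characteristic $0$. The quiver of the stylic algebra $\mathbb{K}\mathrm{Styl}(A)$ is $Q(A)$.
   Context: $A$ is a finite totally ordered set, whose elements are called letters, and $A^*$ is the free monoid on $A$. A column on $A$ is a subset of $A$; $\Gamma(A)$ is the set of columns. Left action of $A^*$ on $\Gamma(A)$: for a letter $a$ and a column $\gamma$, if $a>y$ for all $y\in\gamma$, then $a\cdot\gamma=\gamma\cup\{a\}$; otherwise $a\cdot\gamma=(\gamma\setminus\{y\})\cup\{a\}$, where $y$ is the smallest element of $\gamma$ with $y\ge a$. This extends to words by $(uv)\cdot\gamma=u\cdot(v\cdot\gamma)$. The stylic monoid $\mathrm{Styl}(A)$ is the monoid (under composition) of the functions $\mu_w:\Gamma(A)\to\Gamma(A)$, $\gamma\mapsto w\cdot\gamma$, for $w\in A^*$; $\mathbb{K}\mathrm{Styl}(A)$ is its monoid algebra over $\mathbb{K}$. Right action of $A^*$ on $\Gamma(A)$: for a column $\gamma$ and a letter $c$, if $c<x$ for all $x\in\gamma$ (in particular if $\gamma=\emptyset$), then $\gamma\cdot c=\gamma\cup\{c\}$; otherwise $\gamma\cdot c=(\gamma\setminus\{b\})\cup\{c\}$ with $b=\max\{x\in\gamma:x\le c\}$. The right action of $c$ on $\gamma$ is called frank if $\gamma\ne\emptyset$, $c\ge\min(\gamma)$ and $c\notin\gamma$. The quiver $Q(A)$ has vertex set $\Gamma(A)$, and has an arrow (labelled $c$) $\gamma\xrightarrow{c}\gamma'$ for each column $\gamma$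 and letter $c$ such that the right action of $c$ on $\gamma$ is frank and $\gamma\cdot c=\gamma'$. The quiver of a finite-dimensional algebra $\Lambda$ over $\mathbb{K}$ (for which all simple modules are one-dimensional) is meant in the usual (Gabriel) sense: given a complete system $\{e_i\}_{i\in I}$ of primitive orthogonal idempotents of $\Lambda$, its vertex set is $I$ and the number of arrows from $i$ to $j$ is $\dim_{\mathbb{K}}e_i(\mathrm{rad}\,\Lambda/\mathrm{rad}^2\Lambda)e_j$ (paths are multiplied from left to right). Equivalently, it is the unique quiver $Q$, up to isomorphism, such that there is a surjective algebra morphism $\mathbb{K}Q\to\Lambda$ whose kernel $I$ is admissible, i.e. $F^m\subset I\subset F^2$ for some $m\geq 2$, where $F$ is the ideal of $\mathbb{K}Q$ generated by the arrows. The identification of the quiver of $\mathbb{K}\mathrm{Styl}(A)$ with $Q(A)$ is as quivers, forgetting edge labels. *)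

theory Defs
  imports
    "HOL-Library.FuncSet"
    "HOL-Algebra.Ideal_Product"
    "HOL-Algebra.QuotRing"
    "HOL-Algebra.Embedded_Algebras"
    "Graph_Theory.Digraph"
begin

section \<open>Gabriel quivers\<close>

text \<open>
  A nonzero unital algebra over a field is rendered as a ring together with a subfield of
  central elements, as in \<^theory>\<open>HOL-Algebra.Embedded_Algebras\<close>.
\<close>

definition fin_dim_algebra :: "'r set \<Rightarrow> ('r, 'b) ring_scheme \<Rightarrow> bool" where
  "fin_dim_algebra K R \<longleftrightarrow>
     ring R \<and> subfield K R \<and>
     (\<forall>k\<in>K. \<forall>x\<in>carrier R. k \<otimes>\<^bsub>R\<^esub> x = x \<otimes>\<^bsub>R\<^esub> k) \<and>
     ring.finite_dimension R K (carrier R)"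

definition right_ideal :: "'r set \<Rightarrow> ('r, 'b) ring_scheme \<Rightarrow> bool" where
  "right_ideal I R \<longleftrightarrow>
     additive_subgroup I R \<and> (\<forall>x\<in>I. \<forall>r\<in>carrier R. x \<otimes>\<^bsub>R\<^esub> r \<in> I)"

definition maximal_right_ideal :: "'r set \<Rightarrow> ('r, 'b) ring_scheme \<Rightarrow> bool" where
  "maximal_right_ideal I R \<longleftrightarrow>
     right_ideal I R \<and> I \<noteq> carrier R \<and>
     (\<forall>J. right_ideal J R \<and> I \<subseteq> J \<longrightarrow> J = I \<or> J = carrier R)"

definition jacobson_radical :: "('r, 'b) ring_scheme \<Rightarrow> 'r set" where
  "jacobson_radical R = {x \<in> carrier R. \<forall>I. maximal_right_ideal I R \<longrightarrow> x \<in> I}"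

text \<open>
  Every simple right module is isomorphic to \<open>R / I\<close> for a maximal right ideal \<open>I\<close>; as \<open>I\<close> is
  proper, \<open>R / I\<close> is one-dimensional precisely when \<open>K + I = R\<close>.
\<close>

definition simples_one_dimensional :: "'r set \<Rightarrow> ('r, 'b) ring_scheme \<Rightarrow> bool" where
  "simples_one_dimensional K R \<longleftrightarrow>
     (\<forall>I. maximal_right_ideal I R \<longrightarrow> K <+>\<^bsub>R\<^esub> I = carrier R)"

definition idempotent :: "('r, 'b) ring_scheme \<Rightarrow> 'r \<Rightarrow> bool" where
  "idempotent R e \<longleftrightarrow> e \<in> carrier R \<and> e \<otimes>\<^bsub>R\<^esub> e = e"

definition orthogonal_elems :: "('r, 'b) ring_scheme \<Rightarrow> 'r \<Rightarrow> 'r \<Rightarrow> bool" where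
  "orthogonal_elems R e f \<longleftrightarrow> e \<otimes>\<^bsub>R\<^esub> f = \<zero>\<^bsub>R\<^esub> \<and> f \<otimes>\<^bsub>R\<^esub> e = \<zero>\<^bsub>R\<^esub>"

definition primitive_idempotent :: "('r, 'b) ring_scheme \<Rightarrow> 'r \<Rightarrow> bool" where
  "primitive_idempotent R e \<longleftrightarrow>
     idempotent R e \<and> e \<noteq> \<zero>\<^bsub>R\<^esub> \<and>
     (\<forall>f g. idempotent R f \<and> idempotent R g \<and> orthogonal_elems R f g \<and> e = f \<oplus>\<^bsub>R\<^esub> g
        \<longrightarrow> f = \<zero>\<^bsub>R\<^esub> \<or> g = \<zero>\<^bsub>R\<^esub>)"

text \<open>The members of such a system are distinct, so it is indexed by itself.\<close>

definition complete_primitive_system :: "('r, 'b) ring_scheme \<Rightarrow> 'r set \<Rightarrow> bool" where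
  "complete_primitive_system R E \<longleftrightarrow>
     finite E \<and> (\<forall>e\<in>E. primitive_idempotent R e) \<and>
     (\<forall>e\<in>E. \<forall>f\<in>E. e \<noteq> f \<longrightarrow> orthogonal_elems R e f) \<and>
     finsum R (\<lambda>e. e) E = \<one>\<^bsub>R\<^esub>"

definition radical_square :: "('r, 'b) ring_scheme \<Rightarrow> 'r set" where
  "radical_square R = ideal_prod R (jacobson_radical R) (jacobson_radical R)"

text \<open>
  The space \<open>e (rad R / rad\<^sup>2 R) f\<close>, and the field \<open>K\<close>, inside the ring \<open>R / rad\<^sup>2 R\<close>.
\<close>

definition arrow_space :: "('r, 'b) ring_scheme \<Rightarrow> 'r \<Rightarrow> 'r \<Rightarrow> 'r set set" where
  "arrow_space R e f =
     (\<lambda>x. radical_square R +>\<^bsub>R\<^esub> (e \<otimes>\<^bsub>R\<^esub> x \<otimes>\<^bsub>R\<^esub> f)) ` jacobson_radical R"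

definition quotient_scalars :: "'r set \<Rightarrow> ('r, 'b) ring_scheme \<Rightarrow> 'r set set" where
  "quotient_scalars K R = (\<lambda>k. radical_square R +>\<^bsub>R\<^esub> k) ` K"

text \<open>
  \<open>Q\<close> is, up to isomorphism of quivers, the quiver of the \<open>K\<close>-algebra \<open>R\<close>. The result does not
  depend on the complete system of primitive orthogonal idempotents; existence of such a system
  is required so that the quantification over all of them is not vacuous.
\<close>

definition is_gabriel_quiver ::
  "'r set \<Rightarrow> ('r, 'b) ring_scheme \<Rightarrow> ('v, 'e) pre_digraph \<Rightarrow> bool" where
  "is_gabriel_quiver K R Q \<longleftrightarrow>
     fin_dim_algebra K R \<and> simples_one_dimensional K R \<and> fin_digraph Q \<and>
     (\<exists>E. complete_primitive_system R E) \<and>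
     (\<forall>E. complete_primitive_system R E \<longrightarrow>
        (\<exists>\<phi>. bij_betw \<phi> E (verts Q) \<and>
           (\<forall>e\<in>E. \<forall>f\<in>E.
              ring.dimension (R Quot radical_square R)
                (card {a \<in> arcs Q. tail Q a = \<phi> e \<and> head Q a = \<phi> f})
                (quotient_scalars K R) (arrow_space R e f))))"

section \<open>Monoid algebras\<close>

text \<open>Elements are finitely supported functions on the monoid; the product is convolution.\<close>

definition monoid_algebra :: "('m, 'b) monoid_scheme \<Rightarrow> ('m \<Rightarrow> 'k::field) ring" where
  "monoid_algebra M =
     \<lparr> carrier = {f. finite {m. f m \<noteq> 0} \<and> {m. f m \<noteq> 0} \<subseteq> carrier M},
       mult = (\<lambda>f g m. \<Sum>(x, y) \<in> {(x, y). f x \<noteq> 0 \<and> g y \<noteq> 0 \<and> x \<otimes>\<^bsub>M\<^esub> y = m}. f x * g y),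
       one = (\<lambda>m. if m = \<one>\<^bsub>M\<^esub> then 1 else 0),
       zero = (\<lambda>m. 0),
       add = (\<lambda>f g m. f m + g m) \<rparr>"

definition scalars :: "('m, 'b) monoid_scheme \<Rightarrow> ('m \<Rightarrow> 'k::field) set" where
  "scalars M = range (\<lambda>c m. if m = \<one>\<^bsub>M\<^esub> then c else 0)"

section \<open>The stylic monoid\<close>

definition columns :: "'a set \<Rightarrow> 'a set set" where
  "columns A = Pow A"

definition left_act :: "'a::linorder \<Rightarrow> 'a set \<Rightarrow> 'a set" where
  "left_act a \<gamma> =
     (if \<forall>y\<in>\<gamma>. a > y then \<gamma> \<union> {a} else (\<gamma> - {Min {y \<in> \<gamma>. y \<ge> a}}) \<union> {a})"

definition left_act_word :: "'a::linorder list \<Rightarrow> 'a set \<Rightarrow> 'a set" where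
  "left_act_word w \<gamma> = foldr left_act w \<gamma>"

definition stylic_map :: "'a::linorder set \<Rightarrow> 'a list \<Rightarrow> 'a set \<Rightarrow> 'a set" where
  "stylic_map A w = restrict (left_act_word w) (columns A)"

definition Styl :: "'a::linorder set \<Rightarrow> ('a set \<Rightarrow> 'a set) monoid" where
  "Styl A =
     \<lparr> carrier = stylic_map A ` lists A,
       mult = compose (columns A),
       one = restrict id (columns A) \<rparr>"

section \<open>The quiver of columns\<close>

definition right_act :: "'a::linorder set \<Rightarrow> 'a \<Rightarrow> 'a set" where
  "right_act \<gamma> c =
     (if \<forall>x\<in>\<gamma>. c < x then \<gamma> \<union> {c} else (\<gamma> - {Max {x \<in> \<gamma>. x \<le> c}}) \<union> {c})"

definition frank :: "'a::linorder set \<Rightarrow> 'a \<Rightarrow> bool" where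
  "frank \<gamma> c \<longleftrightarrow> \<gamma> \<noteq> {} \<and> c \<ge> Min \<gamma> \<and> c \<notin> \<gamma>"

definition column_quiver :: "'a::linorder set \<Rightarrow> ('a set, 'a set \<times> 'a) pre_digraph" where
  "column_quiver A =
     \<lparr> verts = columns A,
       arcs = {(\<gamma>, c). \<gamma> \<in> columns A \<and> c \<in> A \<and> frank \<gamma> c},
       tail = fst,
       head = (\<lambda>(\<gamma>, c). right_act \<gamma> c) \<rparr>"

end

theory Submission
  imports Defs "HOL-Computational_Algebra.Polynomial"
begin

text \<open>
  Write \<open>R\<close> for the algebra of \<open>Styl(A)\<close>. The letters of a word \<open>w\<close> can be read off the map
  \<open>\<mu> w\<close>: the letter \<open>b\<close> occurs in \<open>w\<close> iff it lies in \<open>w \<cdot> {y. y < b}\<close>. Hence every \<open>B \<subseteq> A\<close>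
  defines a character of \<open>R\<close>, which sends \<open>w\<close> to \<open>1\<close> if all letters of \<open>w\<close> lie in \<open>B\<close> and to
  \<open>0\<close> otherwise. Let \<open>N\<close> be the common kernel of these characters. A letter either fixes a
  column or raises its rank (\<open>left_act_rank\<close>), so left multiplication is triangular in the basis
  of monoid elements, its diagonal entries are values of the characters, and \<open>N\<close> is nil. It
  follows that \<open>N\<close> is the radical, that \<open>R / N\<close> is a product of copies of the field indexed by
  the columns, and, by lifting idempotents, that every complete system of primitive idempotents is
  in bijection with the columns: the idempotent \<open>e\<close> belongs to \<open>B\<close> if the character of \<open>B\<close> is
  the one that does not kill \<open>e\<close> (\<open>weights_of_system\<close>).

  Let \<open>e\<close> and \<open>f\<close> belong to \<open>B\<close> and \<open>C\<close>. On \<open>N / N\<^sup>2\<close> they act through their classes modulo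
  \<open>N\<close>. On \<open>e (N / N\<^sup>2) f\<close> a letter \<open>a\<close> therefore acts from the left as the scalar \<open>1\<close> or \<open>0\<close>
  according to whether \<open>a \<in> B\<close>, and from the right according to whether \<open>a \<in> C\<close>. Two words with
  the same letters become equal once letters are idempotent and commute, so \<open>N\<close> is generated as an
  ideal by the commutators \<open>[x, z]\<close> of letters (\<open>N_generated\<close>), and these span \<open>e (N / N\<^sup>2) f\<close>.
  The Knuth relations say \<open>[x, z] y = 0\<close> for \<open>x \<le> y < z\<close> and \<open>y [x, z] = 0\<close> for
  \<open>x < y \<le> z\<close>. Together with \<open>a\<^sup>2 = a\<close> and the Jacobi identity they kill \<open>[x, z]\<close>, for
  \<open>x < z\<close>, unless \<open>C\<close> arises from \<open>B\<close> by sliding the element \<open>x\<close> up to \<open>z\<close> across no other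
  element of \<open>B\<close> (\<open>com_in_Z\<close>). That is exactly the frank right action of \<open>z\<close> on \<open>B\<close>, and \<open>B\<close>
  and \<open>C\<close> determine \<open>x\<close> and \<open>z\<close>. This bounds the number of arrows from above.

  For the lower bound, a slide from \<open>B\<close> to \<open>C\<close> gives a derivation of \<open>R\<close>, with values in the
  bimodule on which \<open>R\<close> acts through the characters of \<open>B\<close> and \<open>C\<close>, that sends \<open>z\<close> to \<open>1\<close> and
  every other letter to \<open>0\<close> (\<open>crossing_mult\<close>). It vanishes on \<open>N\<^sup>2\<close>, but takes the value \<open>1\<close> on
  \<open>[x, z]\<close>.
\<close>

section \<open>Split algebras with nil radical\<close>

lemma (in ring) right_idealI:
  assumes "J \<subseteq> carrier R" "\<zero> \<in> J" "\<And>x y. x \<in> J \<Longrightarrow> y \<in> J \<Longrightarrow> x \<oplus> y \<in> J"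
    and r: "\<And>x r. x \<in> J \<Longrightarrow> r \<in> carrier R \<Longrightarrow> x \<otimes> r \<in> J"
  shows "right_ideal J R"
proof -
  have "\<ominus> x \<in> J" if "x \<in> J" for x
  proof -
    have "\<ominus> x = x \<otimes> (\<ominus> \<one>)" using that assms(1) by (auto simp: r_minus)
    then show ?thesis using r[OF that, of "\<ominus> \<one>"] by simp
  qed
  then have "additive_subgroup J R"
    using assms by (intro additive_subgroup.intro add.subgroupI) (auto simp: a_inv_def)
  then show ?thesis using r by (auto simp: right_ideal_def)
qed

lemma (in ring) right_idealD:
  assumes "right_ideal J R"
  shows "\<And>x. x \<in> J \<Longrightarrow> x \<in> carrier R" "\<zero> \<in> J"
    "\<And>x y. x \<in> J \<Longrightarrow> y \<in> J \<Longrightarrow> x \<oplus> y \<in> J"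
    "\<And>x r. x \<in> J \<Longrightarrow> r \<in> carrier R \<Longrightarrow> x \<otimes> r \<in> J"
proof -
  interpret additive_subgroup J R using assms by (simp add: right_ideal_def)
  show "\<And>x. x \<in> J \<Longrightarrow> x \<in> carrier R" "\<zero> \<in> J" "\<And>x y. x \<in> J \<Longrightarrow> y \<in> J \<Longrightarrow> x \<oplus> y \<in> J"
    by (simp_all add: a_Hcarr)
  show "\<And>x r. x \<in> J \<Longrightarrow> r \<in> carrier R \<Longrightarrow> x \<otimes> r \<in> J"
    using assms by (simp add: right_ideal_def)
qed

text \<open>
  A finite-dimensional algebra whose simple modules are one-dimensional is described by the
  characters through which it acts on them: finitely many distinct characters with nil common
  kernel. The field is a type, embedded in the centre of the ring by \<open>emb\<close>.
\<close>
locale split_algebra = ring R for R :: "('r, 'b) ring_scheme" (structure) +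
  fixes emb :: "'k::field \<Rightarrow> 'r" and V :: "'v set" and \<chi> :: "'v \<Rightarrow> 'r \<Rightarrow> 'k"
  assumes emb_closed [simp]: "emb c \<in> carrier R"
    and emb_one: "emb 1 = \<one>"
    and emb_add: "emb (c + d) = emb c \<oplus> emb d"
    and emb_mult: "emb (c * d) = emb c \<otimes> emb d"
    and emb_central: "x \<in> carrier R \<Longrightarrow> emb c \<otimes> x = x \<otimes> emb c"
    and one_neq_zero: "\<one> \<noteq> \<zero>"
    and finite_V: "finite V"
    and chi_emb [simp]: "i \<in> V \<Longrightarrow> \<chi> i (emb c) = c"
    and chi_add [simp]: "i \<in> V \<Longrightarrow> x \<in> carrier R \<Longrightarrow> y \<in> carrier R \<Longrightarrow> \<chi> i (x \<oplus> y) = \<chi> i x + \<chi> i y"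
    and chi_mult [simp]: "i \<in> V \<Longrightarrow> x \<in> carrier R \<Longrightarrow> y \<in> carrier R \<Longrightarrow> \<chi> i (x \<otimes> y) = \<chi> i x * \<chi> i y"
    and chi_distinct: "i \<in> V \<Longrightarrow> j \<in> V \<Longrightarrow> i \<noteq> j \<Longrightarrow> \<exists>r\<in>carrier R. \<chi> i r \<noteq> \<chi> j r"
    and kernel_nil: "x \<in> carrier R \<Longrightarrow> (\<And>i. i \<in> V \<Longrightarrow> \<chi> i x = 0) \<Longrightarrow> \<exists>n::nat. x [^] n = \<zero>"
begin

definition N :: "'r set" where
  "N = {x \<in> carrier R. \<forall>i\<in>V. \<chi> i x = 0}"

lemma emb_zero: "emb 0 = \<zero>"
  using emb_add[of 0 0] emb_closed[of 0] by (metis add.r_cancel_one' add_0)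

lemma chi_zero [simp]: "i \<in> V \<Longrightarrow> \<chi> i \<zero> = 0"
  using chi_emb[of i 0] by (simp add: emb_zero)

lemma chi_one [simp]: "i \<in> V \<Longrightarrow> \<chi> i \<one> = 1"
  using chi_emb[of i 1] by (simp add: emb_one)

lemma chi_uminus [simp]: "i \<in> V \<Longrightarrow> x \<in> carrier R \<Longrightarrow> \<chi> i (\<ominus> x) = - \<chi> i x"
  using chi_add[of i x "\<ominus> x"] by (simp add: r_neg eq_neg_iff_add_eq_0 add.commute)

lemma chi_minus [simp]:
  "i \<in> V \<Longrightarrow> x \<in> carrier R \<Longrightarrow> y \<in> carrier R \<Longrightarrow> \<chi> i (x \<ominus> y) = \<chi> i x - \<chi> i y"
  by (simp add: a_minus_def)

lemma chi_finsum:
  assumes "i \<in> V" "finite E" "E \<subseteq> carrier R"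
  shows "\<chi> i (finsum R (\<lambda>e. e) E) = (\<Sum>e\<in>E. \<chi> i e)"
  using assms(2,3)
proof (induction E rule: finite_induct)
  case (insert e E)
  then have "finsum R (\<lambda>e. e) (insert e E) = e \<oplus> finsum R (\<lambda>e. e) E"
    by (intro finsum_insert) auto
  moreover have "finsum R (\<lambda>e. e) E \<in> carrier R" using insert.prems by (intro finsum_closed) auto
  ultimately show ?case using insert assms(1) by simp
qed (use assms in simp)

text \<open>
  As in Lagrange interpolation, the product over \<open>j \<noteq> i\<close> of normalised elements separating \<open>\<chi> i\<close>
  from \<open>\<chi> j\<close> is a preimage of the \<open>i\<close>-th unit vector of \<open>R / N\<close>.
\<close>
lemma indicator_exists:
  assumes i: "i \<in> V"
  shows "\<exists>u\<in>carrier R. \<forall>j\<in>V. \<chi> j u = (if j = i then 1 else 0)"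
proof -
  have "\<exists>u\<in>carrier R. \<chi> i u = 1 \<and> (\<forall>j\<in>J. \<chi> j u = 0)" if "finite J" "J \<subseteq> V - {i}" for J
    using that
  proof (induction J rule: finite_induct)
    case empty
    then show ?case using i by (intro bexI[of _ \<one>]) auto
  next
    case (insert j J)
    then obtain u where u: "u \<in> carrier R" "\<chi> i u = 1" "\<forall>j\<in>J. \<chi> j u = 0" by auto
    have j: "j \<in> V" "j \<noteq> i" using insert.prems by auto
    obtain r where r: "r \<in> carrier R" "\<chi> i r \<noteq> \<chi> j r" using chi_distinct[OF i j(1)] j(2) by auto
    let ?v = "emb (inverse (\<chi> i r - \<chi> j r)) \<otimes> (r \<oplus> emb (- \<chi> j r))"
    have "?v \<in> carrier R" "\<chi> i ?v = 1" "\<chi> j ?v = 0" using r i j by simp_all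
    then show ?case using u i j insert.prems by (intro bexI[of _ "u \<otimes> ?v"]) auto
  qed
  from this[of "V - {i}"] finite_V obtain u where "u \<in> carrier R" "\<chi> i u = 1" "\<forall>j\<in>V - {i}. \<chi> j u = 0"
    by blast
  then show ?thesis by (intro bexI[of _ u]) auto
qed

lemma N_closed: "x \<in> N \<Longrightarrow> x \<in> carrier R"
  by (simp add: N_def)

lemma ideal_N: "ideal N R"
proof (rule idealI[OF ring_axioms])
  show "subgroup N (add_monoid R)"
    by (rule add.subgroupI) (auto simp: N_def a_inv_def[symmetric] intro: exI[of _ \<zero>])
qed (auto simp: N_def)

lemma N_zero: "\<zero> \<in> N" and N_add: "x \<in> N \<Longrightarrow> y \<in> N \<Longrightarrow> x \<oplus> y \<in> N"
  and N_left: "r \<in> carrier R \<Longrightarrow> x \<in> N \<Longrightarrow> r \<otimes> x \<in> N"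
  and N_right: "r \<in> carrier R \<Longrightarrow> x \<in> N \<Longrightarrow> x \<otimes> r \<in> N"
  by (auto simp: N_def)

text \<open>
  Otherwise \<open>J + N = R\<close>, say \<open>1 = j + m\<close>. Multiplying by \<open>m ^ k\<close> shows that \<open>m ^ (k + 1) \<in> J\<close>
  implies \<open>m ^ k \<in> J\<close>, and one descends from a vanishing power of \<open>m\<close> to \<open>1 \<in> J\<close>.
\<close>
lemma N_subset_maximal:
  assumes J: "maximal_right_ideal J R"
  shows "N \<subseteq> J"
proof (rule ccontr)
  assume "\<not> N \<subseteq> J"
  then obtain n where n: "n \<in> N" "n \<notin> J" by auto
  have rJ: "right_ideal J R" "J \<noteq> carrier R" using J by (auto simp: maximal_right_ideal_def)
  note D = right_idealD[OF rJ(1)]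
  let ?J = "{j \<oplus> m |j m. j \<in> J \<and> m \<in> N}"
  have "right_ideal ?J R"
  proof (rule right_idealI)
    show "?J \<subseteq> carrier R" using D(1) N_closed by auto
    show "\<zero> \<in> ?J" using D(2) N_zero by (intro CollectI exI[of _ \<zero>]) auto
    show "x \<oplus> y \<in> ?J" if "x \<in> ?J" "y \<in> ?J" for x y
    proof -
      from that obtain j m j' m' where *: "x = j \<oplus> m" "y = j' \<oplus> m'" "j \<in> J" "j' \<in> J" "m \<in> N" "m' \<in> N"
        by auto
      then have "x \<oplus> y = (j \<oplus> j') \<oplus> (m \<oplus> m')" using D(1) N_closed by (simp add: a_ac)
      moreover have "j \<oplus> j' \<in> J" "m \<oplus> m' \<in> N" using * D(3) N_add by auto
      ultimately show ?thesis by blast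
    qed
    show "x \<otimes> r \<in> ?J" if "x \<in> ?J" "r \<in> carrier R" for x r
    proof -
      from that obtain j m where *: "x = j \<oplus> m" "j \<in> J" "m \<in> N" by auto
      then have "x \<otimes> r = j \<otimes> r \<oplus> m \<otimes> r" using D(1) N_closed that by (simp add: l_distr)
      moreover have "j \<otimes> r \<in> J" "m \<otimes> r \<in> N" using * D(4) N_right that by auto
      ultimately show ?thesis by blast
    qed
  qed
  moreover have "J \<subseteq> ?J"
  proof
    fix j assume "j \<in> J"
    then have "j = j \<oplus> \<zero>" using D(1) by simp
    then show "j \<in> ?J" using \<open>j \<in> J\<close> N_zero by blast
  qed
  moreover have "n \<in> ?J"
  proof -
    have "n = \<zero> \<oplus> n" using n N_closed by simp
    then show ?thesis using n D(2) by blast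
  qed
  ultimately have "?J = carrier R" using J n unfolding maximal_right_ideal_def by blast
  then have "\<one> \<in> ?J" by simp
  then obtain j m where jm: "\<one> = j \<oplus> m" "j \<in> J" "m \<in> N" by blast
  have m: "m \<in> carrier R" "j \<in> carrier R" using jm N_closed D(1) by auto
  have down: "m [^] k \<in> J" if "m [^] Suc k \<in> J" for k :: nat
  proof -
    have "m [^] k = (j \<oplus> m) \<otimes> m [^] k" using m by (simp add: jm(1)[symmetric])
    also have "\<dots> = j \<otimes> m [^] k \<oplus> m [^] Suc k" using m by (simp only: l_distr nat_pow_closed nat_pow_Suc2)
    finally have "m [^] k = j \<otimes> m [^] k \<oplus> m [^] Suc k" .
    moreover have "j \<otimes> m [^] k \<in> J" using D(4)[OF jm(2)] m by simp
    ultimately show ?thesis using D(3) that by metis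
  qed
  obtain n :: nat where "m [^] n = \<zero>" using kernel_nil[of m] jm(3) by (auto simp: N_def)
  then have "m [^] n \<in> J" using D(2) by simp
  then have "m [^] (0::nat) \<in> J" by (induction n) (use down in blast)+
  then have "\<one> \<in> J" by simp
  then have "carrier R \<subseteq> J" using D(4)[of \<one>] by auto
  then show False using rJ D(1) by blast
qed

lemma kernel_maximal:
  assumes i: "i \<in> V"
  shows "maximal_right_ideal {x \<in> carrier R. \<chi> i x = 0} R" (is "maximal_right_ideal ?J R")
  unfolding maximal_right_ideal_def
proof (intro conjI allI impI)
  show "right_ideal ?J R" using i by (intro right_idealI) auto
  have "\<one> \<notin> ?J" using i by simp
  then show "?J \<noteq> carrier R" using one_closed by blast
  fix L assume L: "right_ideal L R \<and> ?J \<subseteq> L"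
  note D = right_idealD[OF L[THEN conjunct1]]
  show "L = ?J \<or> L = carrier R"
  proof (cases "L \<subseteq> ?J")
    case False
    then obtain x where x: "x \<in> L" "\<chi> i x \<noteq> 0" using D(1) by auto
    have "r \<in> L" if r: "r \<in> carrier R" for r
    proof -
      let ?y = "x \<otimes> emb (\<chi> i r / \<chi> i x)"
      have y: "?y \<in> L" "?y \<in> carrier R" using D(4)[OF x(1)] D(1)[OF x(1)] by auto
      have "r \<ominus> ?y \<in> L" using L r y x D(1) i by auto
      then have "(r \<ominus> ?y) \<oplus> ?y \<in> L" using D(3) y by simp
      moreover have "(r \<ominus> ?y) \<oplus> ?y = r" using r y by (simp add: a_minus_def a_assoc l_neg)
      ultimately show ?thesis by simp
    qed
    then show ?thesis using D(1) by blast
  qed (use L in blast)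
qed

lemma jacobson_radical_eq: "jacobson_radical R = N"
proof
  show "N \<subseteq> jacobson_radical R"
    using N_subset_maximal N_closed by (auto simp: jacobson_radical_def)
  show "jacobson_radical R \<subseteq> N"
  proof
    fix x assume x: "x \<in> jacobson_radical R"
    have "\<chi> i x = 0" if "i \<in> V" for i
      using x kernel_maximal[OF that] unfolding jacobson_radical_def by blast
    then show "x \<in> N" using x by (simp add: N_def jacobson_radical_def)
  qed
qed

text \<open>
  A maximal right ideal \<open>J\<close> contains \<open>N\<close> but not \<open>1\<close>, so it misses one of the unit vectors
  \<open>u i\<close> modulo \<open>N\<close>. Since \<open>u i \<otimes> r\<close> is congruent to a multiple of \<open>u i\<close>, the space
  \<open>J + K u i\<close> is a right ideal, hence everything; then \<open>u i\<close> itself is congruent to a scalar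
  modulo \<open>J\<close>.
\<close>
lemma simples_one_dimensional: "simples_one_dimensional (range emb) R"
  unfolding simples_one_dimensional_def
proof (intro allI impI)
  fix J assume J: "maximal_right_ideal J R"
  then have rJ: "right_ideal J R" "J \<noteq> carrier R" by (auto simp: maximal_right_ideal_def)
  note D = right_idealD[OF rJ(1)]
  have NJ: "N \<subseteq> J" by (rule N_subset_maximal[OF J])
  have oneJ: "\<one> \<notin> J"
  proof
    assume "\<one> \<in> J"
    then have "carrier R \<subseteq> J" using D(4)[of \<one>] by auto
    then show False using rJ D(1) by blast
  qed
  define u where "u i = (SOME u. u \<in> carrier R \<and> (\<forall>j\<in>V. \<chi> j u = (if j = i then 1 else 0)))" for i
  have u: "u i \<in> carrier R" "\<chi> j (u i) = (if j = i then 1 else 0)" if "i \<in> V" "j \<in> V" for i j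
    using someI_ex[of "\<lambda>u. u \<in> carrier R \<and> (\<forall>j\<in>V. \<chi> j u = (if j = i then 1 else 0))"]
      indicator_exists[OF that(1)] that(2) unfolding u_def by blast+
  have uc: "u i \<in> carrier R" if "i \<in> V" for i using u that by blast
  have "\<exists>i\<in>V. u i \<notin> J"
  proof (rule ccontr)
    assume "\<not> ?thesis"
    then have all: "\<forall>i\<in>V. u i \<in> J" by blast
    have "\<exists>s\<in>J. \<forall>j\<in>V. \<chi> j s = (if j \<in> T then 1 else 0)" if "finite T" "T \<subseteq> V" for T
      using that
    proof (induction T rule: finite_induct)
      case empty
      then show ?case using D(2) by (intro bexI[of _ \<zero>]) auto
    next
      case (insert i T)
      then obtain s where s: "s \<in> J" "\<forall>j\<in>V. \<chi> j s = (if j \<in> T then 1 else 0)" by auto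
      have "s \<oplus> u i \<in> J" using D(3) s all insert.prems by simp
      moreover have "\<chi> j (s \<oplus> u i) = (if j \<in> insert i T then 1 else 0)" if "j \<in> V" for j
        using s u that insert.prems insert.hyps D(1) by auto
      ultimately show ?case by blast
    qed
    from this[OF finite_V] obtain s where s: "s \<in> J" "\<forall>j\<in>V. \<chi> j s = 1" by auto
    then have "\<one> \<ominus> s \<in> J" using NJ D(1) by (auto simp: N_def)
    then have "(\<one> \<ominus> s) \<oplus> s \<in> J" using D(3) s by blast
    moreover have "(\<one> \<ominus> s) \<oplus> s = \<one>" using s D(1) by (simp add: a_minus_def a_assoc l_neg)
    ultimately show False using oneJ by simp
  qed
  then obtain i where i: "i \<in> V" "u i \<notin> J" by auto
  let ?L = "{j \<oplus> emb k \<otimes> u i |j k. j \<in> J}"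
  have "right_ideal ?L R"
  proof (rule right_idealI)
    show "?L \<subseteq> carrier R" using D(1) uc i by auto
    have "\<zero> = \<zero> \<oplus> emb 0 \<otimes> u i" using uc i by (simp add: emb_zero)
    then show "\<zero> \<in> ?L" using D(2) by blast
    show "x \<oplus> y \<in> ?L" if "x \<in> ?L" "y \<in> ?L" for x y
    proof -
      from that obtain j k j' k' where *: "x = j \<oplus> emb k \<otimes> u i" "y = j' \<oplus> emb k' \<otimes> u i" "j \<in> J" "j' \<in> J"
        by auto
      then have "x \<oplus> y = (j \<oplus> j') \<oplus> emb (k + k') \<otimes> u i" using D(1) uc i by (simp add: a_ac emb_add l_distr)
      moreover have "j \<oplus> j' \<in> J" using * D(3) by auto
      ultimately show ?thesis by blast
    qed
    show "x \<otimes> r \<in> ?L" if x: "x \<in> ?L" and r: "r \<in> carrier R" for x r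
    proof -
      from x obtain j k where *: "x = j \<oplus> emb k \<otimes> u i" "j \<in> J" by auto
      have jc: "j \<in> carrier R" and ui: "u i \<in> carrier R" using D(1)[OF *(2)] uc i by auto
      let ?n = "u i \<otimes> r \<ominus> emb (\<chi> i r) \<otimes> u i"
      have nN: "?n \<in> N" using r u i uc by (auto simp: N_def)
      then have "?n \<otimes> emb k \<in> J" using D(4)[OF subsetD[OF NJ nN]] by simp
      then have jn: "j \<otimes> r \<oplus> ?n \<otimes> emb k \<in> J" using D(3)[OF D(4)[OF *(2) r]] by simp
      have nc: "?n \<in> carrier R" using r ui by simp
      have "u i \<otimes> r = ?n \<oplus> emb (\<chi> i r) \<otimes> u i" using r ui by (simp add: a_minus_def a_assoc l_neg)
      then have "x \<otimes> r = j \<otimes> r \<oplus> emb k \<otimes> (?n \<oplus> emb (\<chi> i r) \<otimes> u i)"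
        using r jc ui by (simp add: * l_distr m_assoc)
      also have "\<dots> = (j \<otimes> r \<oplus> ?n \<otimes> emb k) \<oplus> emb (k * \<chi> i r) \<otimes> u i"
        using r jc ui nc by (simp add: r_distr emb_mult m_assoc a_assoc emb_central[OF nc, of k])
      finally show ?thesis using jn by blast
    qed
  qed
  moreover have "J \<subseteq> ?L"
  proof
    fix j assume "j \<in> J"
    then have "j = j \<oplus> emb 0 \<otimes> u i" using D(1) uc i by (simp add: emb_zero)
    then show "j \<in> ?L" using \<open>j \<in> J\<close> by blast
  qed
  moreover have "u i \<in> ?L"
  proof -
    have "u i = \<zero> \<oplus> emb 1 \<otimes> u i" using uc i by (simp add: emb_one)
    then show ?thesis using D(2) by blast
  qed
  ultimately have L: "?L = carrier R" using J i unfolding maximal_right_ideal_def by blast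
  then have "\<one> \<in> ?L" by simp
  then obtain a k where ak: "\<one> = a \<oplus> emb k \<otimes> u i" "a \<in> J" by blast
  have ui: "u i \<in> carrier R" "a \<in> carrier R" using uc i D(1)[OF ak(2)] by auto
  have "k \<noteq> 0" using ak oneJ ui by (auto simp: emb_zero)
  have "emb k \<otimes> u i = \<one> \<oplus> \<ominus> a"
    unfolding ak(1) using ui by (simp add: a_ac r_neg2)
  then have "emb (inverse k) \<otimes> (emb k \<otimes> u i) = emb (inverse k) \<otimes> (\<one> \<oplus> \<ominus> a)" by simp
  moreover have "emb (inverse k) \<otimes> (emb k \<otimes> u i) = u i"
    using \<open>k \<noteq> 0\<close> ui by (simp add: m_assoc[symmetric] emb_mult[symmetric] emb_one)
  ultimately have ueq: "u i = emb (inverse k) \<otimes> (\<one> \<oplus> \<ominus> a)" by simp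
  show "range emb <+> J = carrier R"
  proof
    show "range emb <+> J \<subseteq> carrier R" using D(1) by (auto simp: set_add_def')
    show "carrier R \<subseteq> range emb <+> J"
    proof
      fix r assume "r \<in> carrier R"
      then obtain b l where bl: "r = b \<oplus> emb l \<otimes> u i" "b \<in> J" using L by blast
      have bc: "b \<in> carrier R" using D(1)[OF bl(2)] .
      have "r = b \<oplus> emb l \<otimes> (emb (inverse k) \<otimes> (\<one> \<oplus> \<ominus> a))" using bl ueq by simp
      also have "\<dots> = emb (l * inverse k) \<oplus> (b \<oplus> \<ominus> a \<otimes> emb (l * inverse k))"
        using bc ui emb_central[of "\<ominus> a" "l * inverse k"]
        by (simp add: r_distr m_assoc[symmetric] emb_mult[symmetric] a_lcomm)
      finally have "r = emb (l * inverse k) \<oplus> (b \<oplus> \<ominus> a \<otimes> emb (l * inverse k))" .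
      moreover have "\<ominus> a \<otimes> emb (l * inverse k) \<in> J"
        using D(4)[OF ak(2), of "\<ominus> emb (l * inverse k)"] ui by (simp add: l_minus r_minus)
      then have "b \<oplus> \<ominus> a \<otimes> emb (l * inverse k) \<in> J" using D(3)[OF bl(2)] by simp
      ultimately show "r \<in> range emb <+> J" unfolding set_add_def' by blast
    qed
  qed
qed

section \<open>Lifting idempotents\<close>

text \<open>
  Horner evaluation at an element of a noncommutative algebra. It is multiplicative because the
  powers of \<open>y\<close> commute, which transfers divisibility of polynomials to \<open>R\<close>.
\<close>
definition poly_eval :: "'r \<Rightarrow> 'k poly \<Rightarrow> 'r" where
  "poly_eval y p = fold_coeffs (\<lambda>a r. emb a \<oplus> y \<otimes> r) p \<zero>"

context
  fixes y assumes y: "y \<in> carrier R"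
begin

lemma poly_eval_0 [simp]: "poly_eval y 0 = \<zero>"
  by (simp add: poly_eval_def)

lemma poly_eval_pCons [simp]: "poly_eval y (pCons a p) = emb a \<oplus> y \<otimes> poly_eval y p"
proof (cases "p = 0 \<and> a = 0")
  case False
  then show ?thesis
    by (cases "p = 0") (auto simp: poly_eval_def)
qed (use y in \<open>simp add: emb_zero\<close>)

lemma poly_eval_closed [simp]: "poly_eval y p \<in> carrier R"
  by (induction p) (use y in auto)

lemma poly_eval_add: "poly_eval y (p + q) = poly_eval y p \<oplus> poly_eval y q"
  by (induction p q rule: poly_induct2) (use y in \<open>simp_all add: emb_add r_distr a_ac\<close>)

lemma poly_eval_smult: "poly_eval y (smult c p) = emb c \<otimes> poly_eval y p"
proof (induction p)
  case (pCons a p)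
  have "y \<otimes> (emb c \<otimes> poly_eval y p) = emb c \<otimes> (y \<otimes> poly_eval y p)"
    using y by (simp add: m_assoc[symmetric] emb_central[OF y])
  then show ?case using y pCons.IH by (simp add: emb_mult r_distr)
qed simp

lemma poly_eval_mult: "poly_eval y (p * q) = poly_eval y p \<otimes> poly_eval y q"
  by (induction p) (use y in \<open>simp_all add: poly_eval_add poly_eval_smult emb_zero l_distr m_assoc\<close>)

lemma poly_eval_1: "poly_eval y 1 = \<one>"
  using y by (simp add: one_pCons emb_one)

lemma poly_eval_power: "poly_eval y (p ^ n) = poly_eval y p [^] n"
  by (induction n) (simp_all add: poly_eval_1 poly_eval_mult power_Suc2 del: power_Suc)

lemma chi_poly_eval: "i \<in> V \<Longrightarrow> \<chi> i (poly_eval y p) = poly p (\<chi> i y)"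
  by (induction p) (use y in simp_all)

text \<open>
  With \<open>(y (1 - y)) ^ n = 0\<close>, the polynomial \<open>p = (1 - (1 - X) ^ n) ^ n\<close> is divisible by
  \<open>X ^ n\<close> and \<open>1 - p\<close> by \<open>(1 - X) ^ n\<close>, so \<open>p (1 - p)\<close> vanishes at \<open>y\<close>. As \<open>X\<close> divides \<open>p\<close>,
  the idempotent \<open>p(y)\<close> stays in the corner \<open>e R e\<close>.
\<close>
lemma idempotent_lift:
  assumes e: "idempotent R e" and ey: "e \<otimes> y = y" "y \<otimes> e = y"
    and y01: "\<And>i. i \<in> V \<Longrightarrow> \<chi> i y = 0 \<or> \<chi> i y = 1"
  shows "\<exists>g. idempotent R g \<and> e \<otimes> g = g \<and> g \<otimes> e = g \<and> (\<forall>i\<in>V. \<chi> i g = \<chi> i y)"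
proof -
  have ec: "e \<in> carrier R" using e by (simp add: idempotent_def)
  define X :: "'k poly" where "X = [:0, 1:]"
  have pX: "poly X c = c" for c by (simp add: X_def)
  have "\<exists>n::nat. poly_eval y (X * (1 - X)) [^] n = \<zero>"
  proof (rule kernel_nil)
    fix i assume "i \<in> V"
    then show "\<chi> i (poly_eval y (X * (1 - X))) = 0" using y01[of i] by (auto simp: chi_poly_eval pX)
  qed simp
  then obtain n :: nat where n: "poly_eval y (X * (1 - X)) [^] n = \<zero>" by blast
  have n0: "n > 0" using n one_neq_zero by (cases n) auto
  define p where "p = (1 - (1 - X) ^ n) ^ n"
  have "X dvd 1 - (1 - X) ^ n"
    unfolding one_diff_power_eq[of "1 - X" n] by simp
  then have Xp: "X ^ n dvd p" unfolding p_def by (rule dvd_power_same)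
  moreover have "(1 - X) ^ n dvd 1 - p"
    unfolding p_def one_diff_power_eq[of "1 - (1 - X) ^ n" n] by simp
  ultimately have "(X * (1 - X)) ^ n dvd p * (1 - p)" by (simp add: power_mult_distrib mult_dvd_mono)
  then obtain a where "p * (1 - p) = (X * (1 - X)) ^ n * a" by blast
  then have z: "poly_eval y (p * (1 - p)) = \<zero>" by (simp add: poly_eval_mult[of "_ ^ _"] poly_eval_power n)
  have "p * p + p * (1 - p) = p" by (simp add: algebra_simps)
  then have "poly_eval y p \<otimes> poly_eval y p \<oplus> poly_eval y (p * (1 - p)) = poly_eval y p"
    by (metis poly_eval_add poly_eval_mult)
  then have idem: "idempotent R (poly_eval y p)" by (simp add: z idempotent_def)
  have "X dvd p" using Xp n0 by (meson dvd_power dvd_trans)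
  then obtain b where b: "p = X * b" by blast
  have evX: "poly_eval y X = y" using y by (simp add: X_def emb_zero emb_one)
  have l: "poly_eval y p = y \<otimes> poly_eval y b" using poly_eval_mult[of X b] by (simp add: evX b)
  have r: "poly_eval y p = poly_eval y b \<otimes> y"
    using poly_eval_mult[of b X] by (simp add: evX b mult.commute)
  have "e \<otimes> poly_eval y p = poly_eval y p" unfolding l using ec y ey by (simp add: m_assoc[symmetric])
  moreover have "poly_eval y p \<otimes> e = poly_eval y p" unfolding r using ec y ey by (simp add: m_assoc)
  moreover have "\<chi> i (poly_eval y p) = \<chi> i y" if "i \<in> V" for i
    using y01[OF that] that n0 by (auto simp: chi_poly_eval p_def pX power_0_left)
  ultimately show ?thesis using idem by blast
qed

end

lemma chi_idempotent: "idempotent R e \<Longrightarrow> i \<in> V \<Longrightarrow> \<chi> i e = 0 \<or> \<chi> i e = 1"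
  using chi_mult[of i e e] by (auto simp: idempotent_def)

lemma idempotent_pow: "idempotent R e \<Longrightarrow> e [^] Suc n = e"
  by (induction n) (auto simp: idempotent_def)

lemma idempotent_nonzero_chi:
  assumes "idempotent R e" "e \<noteq> \<zero>"
  shows "\<exists>i\<in>V. \<chi> i e = 1"
proof (rule ccontr)
  assume "\<not> ?thesis"
  then have "\<And>i. i \<in> V \<Longrightarrow> \<chi> i e = 0" using chi_idempotent[OF assms(1)] by blast
  moreover have ec: "e \<in> carrier R" using assms by (simp add: idempotent_def)
  ultimately obtain n :: nat where "e [^] n = \<zero>" using kernel_nil by blast
  then have "e [^] Suc n = \<zero>" using ec by simp
  then show False using assms idempotent_pow by metis
qed

text \<open>
  The element \<open>e u e\<close>, where \<open>u\<close> is a unit vector modulo \<open>N\<close>, lifts to an idempotent \<open>g\<close> of the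
  corner \<open>e R e\<close>; then \<open>e = g + (e - g)\<close>, and the characters \<open>i\<close> and \<open>j\<close> detect the two parts.
\<close>
lemma idempotent_split:
  assumes e: "idempotent R e" and ij: "i \<in> V" "j \<in> V" "i \<noteq> j" "\<chi> i e = 1" "\<chi> j e = 1"
  shows "\<exists>f g. idempotent R f \<and> idempotent R g \<and> orthogonal_elems R f g \<and> e = f \<oplus> g \<and> f \<noteq> \<zero> \<and> g \<noteq> \<zero>"
proof -
  have ec: "e \<in> carrier R" and ee: "e \<otimes> e = e" using e by (auto simp: idempotent_def)
  obtain u where u: "u \<in> carrier R" "\<forall>l\<in>V. \<chi> l u = (if l = i then 1 else 0)"
    using indicator_exists[OF ij(1)] by blast
  let ?y = "e \<otimes> u \<otimes> e"
  have yc: "?y \<in> carrier R" using ec u by simp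
  have ey: "e \<otimes> ?y = ?y" "?y \<otimes> e = ?y" using ec u ee by (simp_all add: m_assoc) (simp add: m_assoc[symmetric] ee)
  have chiy: "\<chi> l ?y = (if l = i then 1 else 0)" if "l \<in> V" for l using that ec u ij by simp
  obtain g where g: "idempotent R g" "e \<otimes> g = g" "g \<otimes> e = g" "\<forall>l\<in>V. \<chi> l g = (if l = i then 1 else 0)"
    using idempotent_lift[OF yc e ey] chiy by (smt (verit, best))
  have gc: "g \<in> carrier R" and gg: "g \<otimes> g = g" using g by (auto simp: idempotent_def)
  let ?h = "e \<ominus> g"
  have hc: "?h \<in> carrier R" using ec gc by simp
  have gh: "g \<otimes> ?h = \<zero>" and hg: "?h \<otimes> g = \<zero>"
    using ec gc g gg by (simp_all add: a_minus_def r_distr l_distr r_minus l_minus r_neg)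
  have eh: "e \<otimes> ?h = ?h" using ec gc g ee by (simp add: a_minus_def r_distr r_minus)
  have "?h \<otimes> ?h = e \<otimes> ?h \<oplus> \<ominus> (g \<otimes> ?h)"
    using l_distr[OF ec a_inv_closed[OF gc] hc] l_minus[OF gc hc] by (simp add: a_minus_def)
  then have hh: "idempotent R ?h" using gh eh hc by (simp add: idempotent_def)
  have sum: "e = g \<oplus> ?h" using ec gc by (simp add: a_minus_def a_lcomm r_neg)
  have "g \<noteq> \<zero>" using g(4) ij(1) chi_zero[OF ij(1)] by force
  moreover have "\<chi> j ?h = 1" using ij g ec gc by simp
  then have "?h \<noteq> \<zero>" using chi_zero[OF ij(2)] by force
  ultimately show ?thesis using g(1) hh gh hg sum unfolding orthogonal_elems_def by blast
qed

text \<open>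
  On each member the characters take the values \<open>0\<close> and \<open>1\<close>. Primitivity allows at most one value
  \<open>1\<close>, and nilpotency forces at least one; orthogonality and the sum \<open>1\<close> make the resulting map a
  bijection.
\<close>
lemma weights_of_system:
  assumes E: "complete_primitive_system R E"
  shows "\<exists>\<phi>. bij_betw \<phi> E V \<and> (\<forall>e\<in>E. \<forall>i\<in>V. \<chi> i e = (if i = \<phi> e then 1 else 0))"
proof -
  have fin: "finite E" and prim: "\<And>e. e \<in> E \<Longrightarrow> primitive_idempotent R e"
    and orth: "\<And>e f. e \<in> E \<Longrightarrow> f \<in> E \<Longrightarrow> e \<noteq> f \<Longrightarrow> e \<otimes> f = \<zero>"
    and one: "finsum R (\<lambda>e. e) E = \<one>"
    using E by (auto simp: complete_primitive_system_def orthogonal_elems_def)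
  have idem: "idempotent R e" and nz: "e \<noteq> \<zero>" if "e \<in> E" for e
    using prim[OF that] by (auto simp: primitive_idempotent_def)
  have Ec: "E \<subseteq> carrier R" using idem by (auto simp: idempotent_def)
  have "\<exists>!i. i \<in> V \<and> \<chi> i e = 1" if eE: "e \<in> E" for e
  proof -
    have "\<not> (i \<in> V \<and> j \<in> V \<and> i \<noteq> j \<and> \<chi> i e = 1 \<and> \<chi> j e = 1)" for i j
      using idempotent_split[OF idem[OF that], of i j] prim[OF that]
      unfolding primitive_idempotent_def by blast
    moreover obtain i where "i \<in> V" "\<chi> i e = 1" using idempotent_nonzero_chi[OF idem[OF eE] nz[OF eE]] by blast
    ultimately show ?thesis by (intro ex1I[of _ i]) blast+
  qed
  then obtain \<phi> where \<phi>: "\<And>e. e \<in> E \<Longrightarrow> \<phi> e \<in> V \<and> \<chi> (\<phi> e) e = 1"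
    and \<phi>u: "\<And>e i. e \<in> E \<Longrightarrow> i \<in> V \<Longrightarrow> \<chi> i e = 1 \<Longrightarrow> i = \<phi> e" by metis
  have w: "\<chi> i e = (if i = \<phi> e then 1 else 0)" if "e \<in> E" "i \<in> V" for e i
  proof (cases "i = \<phi> e")
    case False
    then have "\<chi> i e \<noteq> 1" using \<phi>u[OF that] by blast
    then show ?thesis using False chi_idempotent[OF idem[OF that(1)] that(2)] by simp
  qed (use \<phi>[OF that(1)] in simp)
  have "inj_on \<phi> E"
  proof (rule inj_onI, rule ccontr)
    fix e f assume ef: "e \<in> E" "f \<in> E" "\<phi> e = \<phi> f" "e \<noteq> f"
    then have "\<chi> (\<phi> e) (e \<otimes> f) = 1" using \<phi> Ec by (metis chi_mult mult_1 subsetD)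
    then show False using orth ef \<phi> by auto
  qed
  moreover have "V \<subseteq> \<phi> ` E"
  proof
    fix i assume i: "i \<in> V"
    have "(\<Sum>e\<in>E. \<chi> i e) = 1" using chi_finsum[OF i fin Ec] one i by simp
    then obtain e where "e \<in> E" "\<chi> i e \<noteq> 0" by (metis sum.neutral zero_neq_one)
    then show "i \<in> \<phi> ` E" using w i by (metis image_eqI)
  qed
  ultimately have "bij_betw \<phi> E V" using \<phi> by (auto simp: bij_betw_def)
  then show ?thesis using w by blast
qed

text \<open>
  Members of an orthogonal system are detected by disjoint nonempty sets of characters, so there is
  a system of maximal cardinality; splitting one of its members would produce a larger one.
\<close>
lemma complete_system_exists: "\<exists>E. complete_primitive_system R E"
proof -
  define P where "P E \<longleftrightarrow> finite E \<and> (\<forall>e\<in>E. idempotent R e \<and> e \<noteq> \<zero>) \<and>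
     (\<forall>e\<in>E. \<forall>f\<in>E. e \<noteq> f \<longrightarrow> orthogonal_elems R e f) \<and> finsum R (\<lambda>e. e) E = \<one>" for E
  have P1: "P {\<one>}" by (simp add: P_def idempotent_def one_neq_zero)
  have bound: "card E \<le> card V" if E: "P E" for E
  proof -
    have "\<exists>i. i \<in> V \<and> \<chi> i e = 1" if "e \<in> E" for e
      using E that idempotent_nonzero_chi[of e] unfolding P_def by blast
    then obtain h where h: "\<And>e. e \<in> E \<Longrightarrow> h e \<in> V \<and> \<chi> (h e) e = 1" by metis
    have "inj_on h E"
    proof (rule inj_onI, rule ccontr)
      fix e f assume ef: "e \<in> E" "f \<in> E" "h e = h f" "e \<noteq> f"
      then have "e \<otimes> f = \<zero>" "e \<in> carrier R" "f \<in> carrier R"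
        using E by (auto simp: P_def orthogonal_elems_def idempotent_def)
      moreover have "\<chi> (h e) e = 1" "\<chi> (h e) f = 1" "h e \<in> V" using h[OF ef(1)] h[OF ef(2)] ef(3) by auto
      ultimately show False using chi_mult[of "h e" e f] by simp
    qed
    then show ?thesis using h finite_V by (meson card_inj_on_le image_subsetI)
  qed
  obtain E where E: "P E" and max: "\<And>E'. P E' \<Longrightarrow> card E' \<le> card E"
    using ex_has_greatest_nat[of P "{\<one>}" card "Suc (card V)"] P1 bound by (metis le_imp_less_Suc)
  have fin: "finite E" and idem: "\<And>e. e \<in> E \<Longrightarrow> idempotent R e" and nz: "\<And>e. e \<in> E \<Longrightarrow> e \<noteq> \<zero>"
    and orth: "\<And>e f. e \<in> E \<Longrightarrow> f \<in> E \<Longrightarrow> e \<noteq> f \<Longrightarrow> orthogonal_elems R e f"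
    and one: "finsum R (\<lambda>e. e) E = \<one>"
    using E by (auto simp: P_def)
  have Ec: "E \<subseteq> carrier R" using idem by (auto simp: idempotent_def)
  have "f = \<zero> \<or> g = \<zero>" if e: "e \<in> E" and fg: "idempotent R f" "idempotent R g" "orthogonal_elems R f g" "e = f \<oplus> g" for e f g
  proof (rule ccontr)
    assume "\<not> ?thesis"
    then have nz': "f \<noteq> \<zero>" "g \<noteq> \<zero>" by auto
    have c: "f \<in> carrier R" "g \<in> carrier R" "f \<otimes> f = f" "g \<otimes> g = g" "f \<otimes> g = \<zero>" "g \<otimes> f = \<zero>"
      using fg by (auto simp: idempotent_def orthogonal_elems_def)
    have ef: "e \<otimes> f = f" "f \<otimes> e = f" "e \<otimes> g = g" "g \<otimes> e = g"
      using c by (simp_all add: fg(4) l_distr r_distr)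
    have ec: "e \<in> carrier R" using e Ec by blast
    have fgne: "f \<noteq> g" using c nz' by auto
    have orth': "orthogonal_elems R x h"
      if h: "h \<in> E - {e}" and x: "x \<in> carrier R" "e \<otimes> x = x" "x \<otimes> e = x" for h x
    proof -
      have hc: "h \<in> carrier R" and o: "e \<otimes> h = \<zero>" "h \<otimes> e = \<zero>"
        using h Ec orth[OF e, of h] by (auto simp: orthogonal_elems_def)
      have "x \<otimes> h = x \<otimes> (e \<otimes> h)" using x hc ec by (simp add: m_assoc[symmetric])
      moreover have "h \<otimes> x = (h \<otimes> e) \<otimes> x" using x hc ec by (simp add: m_assoc)
      ultimately show ?thesis using o x by (simp add: orthogonal_elems_def)
    qed
    have of: "orthogonal_elems R f h" "orthogonal_elems R g h" if "h \<in> E - {e}" for h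
      using orth'[OF that] c ef by auto
    have sym: "orthogonal_elems R x h \<Longrightarrow> orthogonal_elems R h x" for x h
      by (simp add: orthogonal_elems_def)
    have "f \<notin> E - {e}" using of(1)[of f] c nz' by (auto simp: orthogonal_elems_def)
    moreover have "g \<notin> E - {e}" using of(2)[of g] c nz' by (auto simp: orthogonal_elems_def)
    ultimately have fresh: "g \<notin> E - {e}" "f \<notin> insert g (E - {e})" using fgne by auto
    let ?E = "insert f (insert g (E - {e}))"
    have sc: "finsum R (\<lambda>e. e) (E - {e}) \<in> carrier R" using Ec by (intro finsum_closed) auto
    have "finsum R (\<lambda>e. e) ?E = f \<oplus> finsum R (\<lambda>e. e) (insert g (E - {e}))"
      using fin fresh c Ec by (intro finsum_insert) auto
    also have "finsum R (\<lambda>e. e) (insert g (E - {e})) = g \<oplus> finsum R (\<lambda>e. e) (E - {e})"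
      using fin fresh c Ec by (intro finsum_insert) auto
    also have "f \<oplus> (g \<oplus> finsum R (\<lambda>e. e) (E - {e})) = e \<oplus> finsum R (\<lambda>e. e) (E - {e})"
      using c sc by (simp add: fg(4) a_assoc)
    also have "\<dots> = finsum R (\<lambda>e. e) (insert e (E - {e}))"
      using fin ec Ec by (intro finsum_insert[symmetric]) auto
    also have "\<dots> = \<one>" using one e by (simp add: insert_absorb)
    finally have "finsum R (\<lambda>e. e) ?E = \<one>" .
    moreover have "\<forall>x\<in>?E. \<forall>h\<in>?E. x \<noteq> h \<longrightarrow> orthogonal_elems R x h"
      using of sym fg(3) orth by blast
    ultimately have "P ?E" using fin idem nz nz' fg(1,2) by (auto simp: P_def)
    moreover have "card ?E = Suc (card E)"
      using card.remove[OF fin e] fresh fin by (metis card_insert_disjoint finite_Diff finite_insert)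
    ultimately show False using max by fastforce
  qed
  then have "\<forall>e\<in>E. primitive_idempotent R e" using idem nz by (auto simp: primitive_idempotent_def)
  then show ?thesis using fin orth one by (auto simp: complete_primitive_system_def)
qed

section \<open>The arrow spaces of a split algebra\<close>

text \<open>The square of the radical (\<open>radical_square_eq\<close>).\<close>
definition N2 :: "'r set" where
  "N2 = ideal_prod R N N"

lemma radical_square_eq: "radical_square R = N2"
  by (simp add: radical_square_def jacobson_radical_eq N2_def)

lemma ideal_N2: "ideal N2 R"
  unfolding N2_def by (intro ideal_prod_is_ideal ideal_N)

lemma N2_prod: "x \<in> N \<Longrightarrow> y \<in> N \<Longrightarrow> x \<otimes> y \<in> N2"
  unfolding N2_def by (rule ideal_prod.prod)

text \<open>
  The class of \<open>e\<close> modulo \<open>N\<close> is the unit vector at \<open>i\<close>, as for the members of a complete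
  system of primitive idempotents.
\<close>
definition weight :: "'r \<Rightarrow> 'v \<Rightarrow> bool" where
  "weight e i \<longleftrightarrow> e \<in> carrier R \<and> i \<in> V \<and> (\<forall>l\<in>V. \<chi> l e = (if l = i then 1 else 0))"

text \<open>The image of \<open>x\<close> under the projection of \<open>R\<close> onto \<open>e (R / N\<^sup>2) f\<close>.\<close>
definition corner :: "'r \<Rightarrow> 'r \<Rightarrow> 'r \<Rightarrow> 'r set" where
  "corner e f x = N2 +> (e \<otimes> x \<otimes> f)"

lemma coset_N2_eq_iff: "x \<in> carrier R \<Longrightarrow> y \<in> carrier R \<Longrightarrow> N2 +> x = N2 +> y \<longleftrightarrow> x \<ominus> y \<in> N2"
  using quotient_eq_iff_same_a_r_cos[OF ideal_N2] by simp

context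
  fixes e f i j assumes e: "weight e i" and f: "weight f j"
begin

lemma carr [simp]: "e \<in> carrier R" "f \<in> carrier R" "i \<in> V" "j \<in> V"
  using e f by (auto simp: weight_def)

abbreviation "cl \<equiv> corner e f"

lemma corner_add:
  assumes "cl x = cl x'" "cl y = cl y'"
    and [simp]: "x \<in> carrier R" "x' \<in> carrier R" "y \<in> carrier R" "y' \<in> carrier R"
  shows "cl (x \<oplus> y) = cl (x' \<oplus> y')"
proof -
  interpret ideal N2 R by (rule ideal_N2)
  have "cl (x \<oplus> y) = cl x <+> cl y" if "x \<in> carrier R" "y \<in> carrier R" for x y
    using that by (simp add: corner_def l_distr r_distr a_rcos_sum)
  then show ?thesis using assms by simp
qed

lemma corner_emb:
  assumes "cl x = cl x'" and [simp]: "x \<in> carrier R" "x' \<in> carrier R"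
  shows "cl (emb c \<otimes> x) = cl (emb c \<otimes> x')"
proof -
  interpret ideal N2 R by (rule ideal_N2)
  have *: "e \<otimes> (emb c \<otimes> x) \<otimes> f = emb c \<otimes> (e \<otimes> x \<otimes> f)" if [simp]: "x \<in> carrier R" for x
    using emb_central[of e c] by (simp add: m_assoc[symmetric])
  have "e \<otimes> x \<otimes> f \<ominus> e \<otimes> x' \<otimes> f \<in> N2" using assms(1) by (simp add: corner_def coset_N2_eq_iff)
  then have "emb c \<otimes> (e \<otimes> x \<otimes> f \<ominus> e \<otimes> x' \<otimes> f) \<in> N2" by (intro I_l_closed) auto
  then show ?thesis by (simp add: corner_def coset_N2_eq_iff * a_minus_def r_distr r_minus)
qed

text \<open>
  Both \<open>e \<otimes> r\<close> and \<open>\<chi> i r\<close> times \<open>e\<close> have the same characters, so they differ by an element of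
  \<open>N\<close>, whose product with \<open>n\<close> lies in \<open>N\<^sup>2\<close>.
\<close>
lemma corner_left:
  assumes [simp]: "r \<in> carrier R" and n: "n \<in> N"
  shows "cl (r \<otimes> n) = cl (emb (\<chi> i r) \<otimes> n)"
proof -
  have nc [simp]: "n \<in> carrier R" using n by (rule N_closed)
  have "e \<otimes> r \<ominus> e \<otimes> emb (\<chi> i r) \<in> N" using e by (auto simp: N_def weight_def)
  moreover have "n \<otimes> f \<in> N" using n by (simp add: N_right)
  ultimately have "(e \<otimes> r \<ominus> e \<otimes> emb (\<chi> i r)) \<otimes> (n \<otimes> f) \<in> N2" by (rule N2_prod)
  then show ?thesis
    by (simp add: corner_def coset_N2_eq_iff a_minus_def l_distr l_minus m_assoc)
qed

lemma corner_right:
  assumes [simp]: "r \<in> carrier R" and n: "n \<in> N"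
  shows "cl (n \<otimes> r) = cl (emb (\<chi> j r) \<otimes> n)"
proof -
  have nc [simp]: "n \<in> carrier R" using n by (rule N_closed)
  have "r \<otimes> f \<ominus> emb (\<chi> j r) \<otimes> f \<in> N" using f by (auto simp: N_def weight_def)
  moreover have "e \<otimes> n \<in> N" using n by (simp add: N_left)
  ultimately have "(e \<otimes> n) \<otimes> (r \<otimes> f \<ominus> emb (\<chi> j r) \<otimes> f) \<in> N2" by (intro N2_prod)
  moreover have "e \<otimes> n \<otimes> (emb (\<chi> j r) \<otimes> f) = e \<otimes> (emb (\<chi> j r) \<otimes> n) \<otimes> f"
    by (simp add: m_assoc[symmetric] emb_central) (simp add: m_assoc emb_central)
  ultimately show ?thesis
    by (simp add: corner_def coset_N2_eq_iff a_minus_def r_distr r_minus m_assoc)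
qed

text \<open>
  To bound \<open>e (N / N\<^sup>2) f\<close> by the line through \<open>n0\<close>, one shows that this set is all of \<open>N\<close>. It
  is closed under multiplication from both sides, so it suffices to test ideal generators of \<open>N\<close>.
  For \<open>n0 = \<zero>\<close> it consists of the elements that die in the corner.
\<close>
definition multiples :: "'r \<Rightarrow> 'r set" where
  "multiples n0 = {n \<in> N. \<exists>c. cl n = cl (emb c \<otimes> n0)}"

lemma multiplesI: "n \<in> N \<Longrightarrow> cl n = cl (emb c \<otimes> n0) \<Longrightarrow> n \<in> multiples n0"
  by (auto simp: multiples_def)

context
  fixes n0 assumes n0: "n0 \<in> N"
begin

lemma n0_carr [simp]: "n0 \<in> carrier R"
  using n0 by (rule N_closed)

lemma multiples_self: "n0 \<in> multiples n0"
  by (rule multiplesI[where c = 1]) (simp_all add: n0 emb_one)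

lemma multiples_zero: "\<zero> \<in> multiples n0"
  by (rule multiplesI[where c = 0]) (simp_all add: N_zero emb_zero)

lemma multiples_add:
  assumes "x \<in> multiples n0" "y \<in> multiples n0"
  shows "x \<oplus> y \<in> multiples n0"
proof -
  from assms obtain c d where *: "x \<in> N" "y \<in> N" "cl x = cl (emb c \<otimes> n0)" "cl y = cl (emb d \<otimes> n0)"
    by (auto simp: multiples_def)
  then have "cl (x \<oplus> y) = cl (emb c \<otimes> n0 \<oplus> emb d \<otimes> n0)" by (intro corner_add) (simp_all add: N_closed)
  then show ?thesis using * by (intro multiplesI[where c = "c + d"]) (simp_all add: N_add emb_add l_distr)
qed

lemma multiples_emb:
  assumes "x \<in> multiples n0"
  shows "emb d \<otimes> x \<in> multiples n0"
proof -
  from assms obtain c where *: "x \<in> N" "cl x = cl (emb c \<otimes> n0)" by (auto simp: multiples_def)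
  then have "cl (emb d \<otimes> x) = cl (emb d \<otimes> (emb c \<otimes> n0))" by (intro corner_emb) (simp_all add: N_closed)
  then show ?thesis
    using * by (intro multiplesI[where c = "d * c"]) (simp_all add: N_left emb_mult m_assoc)
qed

lemma multiples_cong: "x \<in> N \<Longrightarrow> cl x = cl y \<Longrightarrow> y \<in> multiples n0 \<Longrightarrow> x \<in> multiples n0"
  by (auto simp: multiples_def)

lemma multiples_left: "x \<in> multiples n0 \<Longrightarrow> r \<in> carrier R \<Longrightarrow> r \<otimes> x \<in> multiples n0"
  by (rule multiples_cong[OF _ corner_left multiples_emb]) (auto simp: multiples_def N_left)

lemma multiples_right: "x \<in> multiples n0 \<Longrightarrow> r \<in> carrier R \<Longrightarrow> x \<otimes> r \<in> multiples n0"
  by (rule multiples_cong[OF _ corner_right multiples_emb]) (auto simp: multiples_def N_right)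

lemma emb_cancel: "c \<noteq> 0 \<Longrightarrow> x \<in> carrier R \<Longrightarrow> emb (inverse c) \<otimes> (emb c \<otimes> x) = x"
  by (simp add: m_assoc[symmetric] emb_mult[symmetric] emb_one)

text \<open>
  An element acting on the corner by a nonzero scalar can be cancelled. Relations of the form
  \<open>r \<otimes> x = \<zero>\<close> are exploited through this lemma and its mirror image.
\<close>
lemma multiples_left_cancel:
  assumes "r \<otimes> x \<in> multiples n0" "r \<in> carrier R" "x \<in> N" "\<chi> i r \<noteq> 0"
  shows "x \<in> multiples n0"
proof -
  have "emb (\<chi> i r) \<otimes> x \<in> multiples n0"
    by (rule multiples_cong[OF _ corner_left[symmetric] assms(1)]) (use assms in \<open>auto simp: N_left\<close>)
  from multiples_emb[OF this, of "inverse (\<chi> i r)"] show ?thesis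
    using assms by (simp add: emb_cancel N_closed)
qed

lemma multiples_right_cancel:
  assumes "x \<otimes> r \<in> multiples n0" "r \<in> carrier R" "x \<in> N" "\<chi> j r \<noteq> 0"
  shows "x \<in> multiples n0"
proof -
  have "emb (\<chi> j r) \<otimes> x \<in> multiples n0"
    by (rule multiples_cong[OF _ corner_right[symmetric] assms(1)]) (use assms in \<open>auto simp: N_left\<close>)
  from multiples_emb[OF this, of "inverse (\<chi> j r)"] show ?thesis
    using assms by (simp add: emb_cancel N_closed)
qed

lemma multiples_left_zero: "r \<in> carrier R \<Longrightarrow> x \<in> N \<Longrightarrow> \<chi> i r = 0 \<Longrightarrow> r \<otimes> x \<in> multiples n0"
  using corner_left[of r x] by (intro multiplesI[where c = 0]) (simp_all add: N_left N_closed emb_zero)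

lemma multiples_right_zero: "r \<in> carrier R \<Longrightarrow> x \<in> N \<Longrightarrow> \<chi> j r = 0 \<Longrightarrow> x \<otimes> r \<in> multiples n0"
  using corner_right[of r x] by (intro multiplesI[where c = 0]) (simp_all add: N_right N_closed emb_zero)

lemma multiples_zero_subset: "multiples \<zero> \<subseteq> multiples n0"
proof
  fix x assume "x \<in> multiples \<zero>"
  then have "x \<in> N" "cl x = cl (emb 0 \<otimes> n0)" by (auto simp: multiples_def emb_zero)
  then show "x \<in> multiples n0" by (rule multiplesI)
qed

end

lemma arrow_space_eq: "arrow_space R e f = cl ` N"
  by (simp add: arrow_space_def corner_def jacobson_radical_eq radical_square_eq)

lemma quotient_ring: "ring (R Quot N2)"
  by (rule ideal.quotient_is_ring[OF ideal_N2])

lemma quotient_zero: "\<zero>\<^bsub>R Quot N2\<^esub> = N2"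
  by (simp add: FactRing_def)

lemma corner_zero: "cl \<zero> = N2"
  by (simp add: corner_def a_rcos_zero[OF ideal_N2] additive_subgroup.zero_closed[OF ideal.axioms(1)[OF ideal_N2]])

lemma arrow_space_dim_0:
  assumes "N \<subseteq> multiples \<zero>"
  shows "ring.dimension (R Quot radical_square R) 0 (quotient_scalars K R) (arrow_space R e f)"
proof -
  have "cl n = N2" if "n \<in> N" for n using assms that corner_zero by (auto simp: multiples_def)
  then have "cl ` N = {N2}" using N_zero by (auto simp: image_iff intro: bexI[of _ \<zero>])
  then show ?thesis
    using ring.zero_dim[OF quotient_ring] by (simp add: radical_square_eq arrow_space_eq quotient_zero)
qed

text \<open>
  A derivation into the bimodule with left action \<open>\<chi> i\<close> and right action \<open>\<chi> j\<close> vanishes on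
  \<open>N\<^sup>2\<close>, because both characters vanish on \<open>N\<close>, and it does not distinguish \<open>n\<close> from
  \<open>e \<otimes> n \<otimes> f\<close>.
\<close>
lemma corner_not_zero:
  assumes add: "\<And>x y. x \<in> carrier R \<Longrightarrow> y \<in> carrier R \<Longrightarrow> d (x \<oplus> y) = d x + d y"
    and derivation: "\<And>x y. x \<in> carrier R \<Longrightarrow> y \<in> carrier R \<Longrightarrow> d (x \<otimes> y) = \<chi> i x * d y + d x * \<chi> j y"
    and n: "n \<in> N" "d n \<noteq> 0"
  shows "cl n \<noteq> cl \<zero>"
proof
  assume "cl n = cl \<zero>"
  have [simp]: "n \<in> carrier R" using n N_closed by blast
  have "d x = 0" if "x \<in> N2" for x
    using that unfolding N2_def
  proof (induction x rule: ideal_prod.induct)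
    case (prod x y)
    have "x \<in> carrier R" "y \<in> carrier R" using prod.hyps N_closed by blast+
    then have "d (x \<otimes> y) = \<chi> i x * d y + d x * \<chi> j y" by (rule derivation)
    moreover have "\<chi> i x = 0" "\<chi> j y = 0" using prod.hyps carr(3,4) unfolding N_def by blast+
    ultimately show ?case by simp
  next
    case (sum x y)
    have "ideal_prod R N N \<subseteq> carrier R" using ideal_prod_in_carrier[OF ideal_N ideal_N] .
    then have "x \<in> carrier R" "y \<in> carrier R" using sum.hyps by blast+
    then have "d (x \<oplus> y) = d x + d y" by (rule add)
    then show ?case using sum.IH by simp
  qed
  moreover have "e \<otimes> n \<otimes> f \<in> N2"
  proof -
    have "e \<otimes> n \<otimes> f \<in> N2 +> (e \<otimes> n \<otimes> f)"
      by (rule abelian_subgroup.a_rcos_self[OF abelian_subgroupI3[OF ideal.axioms(1)[OF ideal_N2] is_abelian_group]]) simp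
    then show ?thesis using \<open>cl n = cl \<zero>\<close> by (simp add: corner_zero) (simp add: corner_def)
  qed
  moreover have "\<chi> i e = 1" "\<chi> j f = 1" "\<chi> i n = 0" "\<chi> j n = 0"
    using e f n(1) carr(3,4) unfolding weight_def N_def by simp_all
  then have "d (e \<otimes> n \<otimes> f) = d n"
    using derivation[of "e \<otimes> n" f] derivation[of e n] by simp
  ultimately show False using n by auto
qed

lemma arrow_space_dim_1:
  assumes n0: "n0 \<in> N" and sub: "N \<subseteq> multiples n0" and nz: "cl n0 \<noteq> cl \<zero>"
  shows "ring.dimension (R Quot radical_square R) 1 (quotient_scalars (range emb) R) (arrow_space R e f)"
proof -
  interpret Q: ring "R Quot N2" by (rule quotient_ring)
  interpret h: ring_hom_ring R "R Quot N2" "(+>) N2" by (rule ideal.rcos_ring_hom_ring[OF ideal_N2])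
  have n0c [simp]: "n0 \<in> carrier R" using n0 N_closed by blast
  have v: "cl n0 \<in> carrier (R Quot N2)" unfolding corner_def by (intro h.hom_closed) simp
  have K: "quotient_scalars (range emb) R = range (\<lambda>c. N2 +> emb c)"
    by (auto simp: quotient_scalars_def radical_square_eq)
  have scal: "(N2 +> emb c) \<otimes>\<^bsub>R Quot N2\<^esub> cl n0 = cl (emb c \<otimes> n0)" for c
  proof -
    have "(N2 +> emb c) \<otimes>\<^bsub>R Quot N2\<^esub> cl n0 = N2 +> (emb c \<otimes> (e \<otimes> n0 \<otimes> f))"
      unfolding corner_def by (intro h.hom_mult[symmetric]) auto
    also have "emb c \<otimes> (e \<otimes> n0 \<otimes> f) = e \<otimes> (emb c \<otimes> n0) \<otimes> f"
      using emb_central[of e c] by (simp add: m_assoc[symmetric])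
    finally show ?thesis by (simp add: corner_def)
  qed
  have "cl ` N = Q.line_extension (range (\<lambda>c. N2 +> emb c)) (cl n0) {\<zero>\<^bsub>R Quot N2\<^esub>}"
  proof (rule Set.set_eqI)
    fix u
    have "u \<in> cl ` N \<longleftrightarrow> (\<exists>c. u = cl (emb c \<otimes> n0))"
    proof
      assume "u \<in> cl ` N"
      then show "\<exists>c. u = cl (emb c \<otimes> n0)" using sub by (auto simp: multiples_def)
    next
      assume "\<exists>c. u = cl (emb c \<otimes> n0)"
      then show "u \<in> cl ` N" using n0 N_left emb_closed by blast
    qed
    also have "\<dots> \<longleftrightarrow> u \<in> Q.line_extension (range (\<lambda>c. N2 +> emb c)) (cl n0) {\<zero>\<^bsub>R Quot N2\<^esub>}"
      unfolding Q.line_extension_mem_iff using v by (simp add: scal[symmetric])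
    finally show "u \<in> cl ` N \<longleftrightarrow> u \<in> Q.line_extension (range (\<lambda>c. N2 +> emb c)) (cl n0) {\<zero>\<^bsub>R Quot N2\<^esub>}" .
  qed
  moreover have "Q.dimension (Suc 0) (range (\<lambda>c. N2 +> emb c))
      (Q.line_extension (range (\<lambda>c. N2 +> emb c)) (cl n0) {\<zero>\<^bsub>R Quot N2\<^esub>})"
    using v nz by (intro Q.Suc_dim Q.zero_dim) (auto simp: quotient_zero corner_zero)
  ultimately show ?thesis unfolding radical_square_eq arrow_space_eq K by simp
qed

end

lemma subfield_emb: "subfield (range emb) R"
proof (rule subfieldI)
  show "subcring (range emb) R"
  proof (rule subcringI[OF subringI])
    show "\<one> \<in> range emb" using emb_one[symmetric] by (rule range_eqI)
    show "\<ominus> h \<in> range emb" if h: "h \<in> range emb" for h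
    proof -
      obtain c where c: "h = emb c" using h by blast
      have "emb (- c) \<oplus> emb c = \<zero>" using emb_add[of "- c" c] by (simp add: emb_zero)
      then have "\<ominus> h = emb (- c)" unfolding c by (simp add: minus_equality)
      then show ?thesis by simp
    qed
  qed (auto simp: emb_add[symmetric] emb_mult[symmetric] mult.commute)
  show "Units (R\<lparr>carrier := range emb\<rparr>) = range emb - {\<zero>}"
  proof -
    have nz: "emb c \<noteq> \<zero>" if "emb c \<otimes> x = \<one>" "x \<in> carrier R" for c x
      using that one_neq_zero by auto
    have inv: "emb (inverse c) \<otimes> emb c = \<one>" "emb c \<otimes> emb (inverse c) = \<one>" if "emb c \<noteq> \<zero>" for c
    proof -
      have "c \<noteq> 0" using that emb_zero by auto
      then show "emb (inverse c) \<otimes> emb c = \<one>" "emb c \<otimes> emb (inverse c) = \<one>"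
        by (simp_all add: emb_mult[symmetric] emb_one)
    qed
    show ?thesis
    proof
      show "Units (R\<lparr>carrier := range emb\<rparr>) \<subseteq> range emb - {\<zero>}"
        unfolding Units_def using nz emb_closed one_neq_zero by auto
      show "range emb - {\<zero>} \<subseteq> Units (R\<lparr>carrier := range emb\<rparr>)"
        unfolding Units_def using inv by auto
    qed
  qed
qed

text \<open>
  Since the arrow space of \<open>e\<close> and \<open>f\<close> can be computed from their weights alone, all complete
  systems are covered by a computation for arbitrary elements of given weights.
\<close>
theorem gabriel_quiverI:
  assumes fd: "finite_dimension (range emb) (carrier R)"
    and Q: "fin_digraph Q" "verts Q = V"
    and arrows: "\<And>e f i j. weight e i \<Longrightarrow> weight f j \<Longrightarrow>
      ring.dimension (R Quot radical_square R) (card {a \<in> arcs Q. tail Q a = i \<and> head Q a = j})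
        (quotient_scalars (range emb) R) (arrow_space R e f)"
  shows "is_gabriel_quiver (range emb) R Q"
  unfolding is_gabriel_quiver_def
proof (intro conjI allI impI)
  show "fin_dim_algebra (range emb) R"
    using ring_axioms subfield_emb emb_central fd by (auto simp: fin_dim_algebra_def)
  show "simples_one_dimensional (range emb) R" by (rule simples_one_dimensional)
  show "\<exists>E. complete_primitive_system R E" by (rule complete_system_exists)
  fix E assume E: "complete_primitive_system R E"
  then have Ec: "e \<in> carrier R" if "e \<in> E" for e
    using that by (auto simp: complete_primitive_system_def primitive_idempotent_def idempotent_def)
  obtain \<phi> where \<phi>: "bij_betw \<phi> E V" "\<forall>e\<in>E. \<forall>i\<in>V. \<chi> i e = (if i = \<phi> e then 1 else 0)"
    using weights_of_system[OF E] by blast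
  have "weight e (\<phi> e)" if "e \<in> E" for e
    using that Ec[OF that] bij_betwE[OF \<phi>(1)] \<phi>(2) unfolding weight_def by blast
  then have "\<forall>e\<in>E. \<forall>f\<in>E. ring.dimension (R Quot radical_square R)
          (card {a \<in> arcs Q. tail Q a = \<phi> e \<and> head Q a = \<phi> f})
          (quotient_scalars (range emb) R) (arrow_space R e f)"
    using arrows by simp
  then show "\<exists>\<phi>. bij_betw \<phi> E (verts Q) \<and>
       (\<forall>e\<in>E. \<forall>f\<in>E. ring.dimension (R Quot radical_square R)
          (card {a \<in> arcs Q. tail Q a = \<phi> e \<and> head Q a = \<phi> f})
          (quotient_scalars (range emb) R) (arrow_space R e f))"
    using \<phi>(1) unfolding Q(2) by (intro exI[of _ \<phi>] conjI)
qed (rule Q)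

end

section \<open>Algebras of finite monoids\<close>

definition single :: "'m \<Rightarrow> 'm \<Rightarrow> 'k::field" where
  "single m = (\<lambda>x. if x = m then 1 else 0)"

definition scal :: "('m, 'b) monoid_scheme \<Rightarrow> 'k::field \<Rightarrow> 'm \<Rightarrow> 'k" where
  "scal M c = (\<lambda>m. if m = \<one>\<^bsub>M\<^esub> then c else 0)"

lemma scalars_eq: "scalars M = range (scal M)"
  by (simp add: scalars_def scal_def[abs_def])

locale finite_monoid = monoid M for M :: "('m, 'b) monoid_scheme" (structure) +
  assumes finite_carrier: "finite (carrier M)"
begin

abbreviation R :: "('m \<Rightarrow> 'k::field) ring" where
  "R \<equiv> monoid_algebra M"

text \<open>The linear extension of \<open>g\<close> from the monoid to its algebra.\<close>
definition lin :: "('m \<Rightarrow> 'k) \<Rightarrow> ('m \<Rightarrow> 'k) \<Rightarrow> 'k::field" where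
  "lin g f = (\<Sum>m\<in>carrier M. f m * g m)"

lemma carrier_iff: "f \<in> carrier R \<longleftrightarrow> (\<forall>m. m \<notin> carrier M \<longrightarrow> f m = 0)"
proof -
  have "{m. f m \<noteq> 0} \<subseteq> carrier M \<Longrightarrow> finite {m. f m \<noteq> 0}"
    using finite_subset finite_carrier by blast
  then show ?thesis by (auto simp: monoid_algebra_def)
qed

lemma add_apply: "(f \<oplus>\<^bsub>R\<^esub> g) = (\<lambda>m. f m + g m)"
  and zero_apply: "\<zero>\<^bsub>R\<^esub> = (\<lambda>m. 0)"
  and one_apply: "\<one>\<^bsub>R\<^esub> = single \<one>"
  by (simp_all add: monoid_algebra_def single_def)

lemma mult_apply:
  assumes "f \<in> carrier R" "g \<in> carrier R"
  shows "(f \<otimes>\<^bsub>R\<^esub> g) m = (\<Sum>x\<in>carrier M. \<Sum>y\<in>carrier M. if x \<otimes> y = m then f x * g y else 0)"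
proof -
  have "(f \<otimes>\<^bsub>R\<^esub> g) m = (\<Sum>(x, y) \<in> {(x, y). f x \<noteq> 0 \<and> g y \<noteq> 0 \<and> x \<otimes> y = m}. f x * g y)"
    by (simp add: monoid_algebra_def)
  also have "\<dots> = (\<Sum>(x, y) \<in> carrier M \<times> carrier M. if x \<otimes> y = m then f x * g y else 0)"
    using assms finite_carrier
    by (intro sum.mono_neutral_cong_left) (auto simp: carrier_iff split: if_splits)
  also have "\<dots> = (\<Sum>x\<in>carrier M. \<Sum>y\<in>carrier M. if x \<otimes> y = m then f x * g y else 0)"
    by (simp add: sum.cartesian_product)
  finally show ?thesis .
qed

lemma mult_closed:
  assumes "f \<in> carrier R" "g \<in> carrier R"
  shows "f \<otimes>\<^bsub>R\<^esub> g \<in> carrier R"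
  unfolding carrier_iff by (auto simp: mult_apply[OF assms] intro!: sum.neutral)

lemma lin_add: "lin g (f \<oplus>\<^bsub>R\<^esub> f') = lin g f + lin g f'"
  by (simp add: lin_def add_apply sum.distrib algebra_simps)

lemma lin_mult:
  assumes "f \<in> carrier R" "f' \<in> carrier R"
  shows "lin g (f \<otimes>\<^bsub>R\<^esub> f') = (\<Sum>x\<in>carrier M. \<Sum>y\<in>carrier M. f x * f' y * g (x \<otimes> y))"
proof -
  have "lin g (f \<otimes>\<^bsub>R\<^esub> f')
      = (\<Sum>m\<in>carrier M. \<Sum>x\<in>carrier M. \<Sum>y\<in>carrier M. if x \<otimes> y = m then f x * f' y * g m else 0)"
    unfolding lin_def mult_apply[OF assms] sum_distrib_right by (intro sum.cong) auto
  also have "\<dots> = (\<Sum>x\<in>carrier M. \<Sum>y\<in>carrier M. \<Sum>m\<in>carrier M. if x \<otimes> y = m then f x * f' y * g m else 0)"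
    by (subst sum.swap, rule sum.cong[OF refl], rule sum.swap)
  also have "\<dots> = (\<Sum>x\<in>carrier M. \<Sum>y\<in>carrier M. f x * f' y * g (x \<otimes> y))"
    using finite_carrier by (intro sum.cong refl) (simp add: sum.delta')
  finally show ?thesis .
qed

lemma mult_eq_lin:
  assumes "f \<in> carrier R" "f' \<in> carrier R"
  shows "(f \<otimes>\<^bsub>R\<^esub> f') m = (\<Sum>y\<in>carrier M. f' y * lin (\<lambda>x. if x \<otimes> y = m then 1 else 0) f)"
    and "(f \<otimes>\<^bsub>R\<^esub> f') m = (\<Sum>x\<in>carrier M. f x * lin (\<lambda>y. if x \<otimes> y = m then 1 else 0) f')"
proof -
  show "(f \<otimes>\<^bsub>R\<^esub> f') m = (\<Sum>x\<in>carrier M. f x * lin (\<lambda>y. if x \<otimes> y = m then 1 else 0) f')"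
    unfolding mult_apply[OF assms] lin_def sum_distrib_left by (intro sum.cong refl) auto
  show "(f \<otimes>\<^bsub>R\<^esub> f') m = (\<Sum>y\<in>carrier M. f' y * lin (\<lambda>x. if x \<otimes> y = m then 1 else 0) f)"
    unfolding mult_apply[OF assms] lin_def sum_distrib_left
    by (subst sum.swap) (intro sum.cong refl, auto)
qed

lemma mult_assoc:
  assumes f: "f \<in> carrier R" and g: "g \<in> carrier R" and h: "h \<in> carrier R"
  shows "(f \<otimes>\<^bsub>R\<^esub> g) \<otimes>\<^bsub>R\<^esub> h = f \<otimes>\<^bsub>R\<^esub> (g \<otimes>\<^bsub>R\<^esub> h)"
proof
  fix m
  have "((f \<otimes>\<^bsub>R\<^esub> g) \<otimes>\<^bsub>R\<^esub> h) m
      = (\<Sum>z\<in>carrier M. \<Sum>x\<in>carrier M. \<Sum>y\<in>carrier M. h z * (f x * g y * (if x \<otimes> y \<otimes> z = m then 1 else 0)))"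
    unfolding mult_eq_lin(1)[OF mult_closed[OF f g] h] lin_mult[OF f g] by (simp add: sum_distrib_left)
  also have "\<dots> = (\<Sum>x\<in>carrier M. \<Sum>z\<in>carrier M. \<Sum>y\<in>carrier M. h z * (f x * g y * (if x \<otimes> y \<otimes> z = m then 1 else 0)))"
    by (rule sum.swap)
  also have "\<dots> = (\<Sum>x\<in>carrier M. \<Sum>y\<in>carrier M. \<Sum>z\<in>carrier M. h z * (f x * g y * (if x \<otimes> y \<otimes> z = m then 1 else 0)))"
    by (rule sum.cong[OF refl], rule sum.swap)
  also have "\<dots> = (\<Sum>x\<in>carrier M. \<Sum>y\<in>carrier M. \<Sum>z\<in>carrier M. f x * (g y * h z * (if x \<otimes> (y \<otimes> z) = m then 1 else 0)))"
    by (intro sum.cong refl) (simp add: m_assoc)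
  also have "\<dots> = (f \<otimes>\<^bsub>R\<^esub> (g \<otimes>\<^bsub>R\<^esub> h)) m"
    unfolding mult_eq_lin(2)[OF f mult_closed[OF g h]] lin_mult[OF g h] by (simp add: sum_distrib_left)
  finally show "((f \<otimes>\<^bsub>R\<^esub> g) \<otimes>\<^bsub>R\<^esub> h) m = (f \<otimes>\<^bsub>R\<^esub> (g \<otimes>\<^bsub>R\<^esub> h)) m" .
qed

lemma single_closed [simp]: "m \<in> carrier M \<Longrightarrow> single m \<in> carrier R"
  by (auto simp: carrier_iff single_def)

lemma lin_single [simp]: "m \<in> carrier M \<Longrightarrow> lin g (single m) = g m"
  using finite_carrier by (simp add: lin_def single_def if_distrib[of "\<lambda>x. x * _"] cong: if_cong)

lemma single_mult:
  assumes "x \<in> carrier M" "y \<in> carrier M"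
  shows "single x \<otimes>\<^bsub>R\<^esub> single y = single (x \<otimes> y)"
proof
  fix m
  have "(single x \<otimes>\<^bsub>R\<^esub> single y) m = (\<Sum>z\<in>carrier M. single x z * lin (\<lambda>y. if z \<otimes> y = m then 1 else 0) (single y))"
    using assms by (intro mult_eq_lin(2)) auto
  also have "\<dots> = lin (\<lambda>z. if z \<otimes> y = m then 1 else 0) (single x)"
    using assms(2) by (simp add: lin_def[of _ "single x"])
  finally show "(single x \<otimes>\<^bsub>R\<^esub> single y) m = single (x \<otimes> y) m"
    using assms(1) by (simp add: single_def[of "x \<otimes> y"] eq_commute[of m])
qed

lemma scal_eq: "scal M c = (\<lambda>m. c * single \<one> m)"
  by (auto simp: scal_def single_def)

lemma scal_closed [simp]: "scal M c \<in> carrier R"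
  by (auto simp: carrier_iff scal_def)

lemma lin_scal [simp]: "lin g (scal M c) = c * g \<one>"
  using finite_carrier by (simp add: lin_def scal_def if_distrib[of "\<lambda>x. x * _"] cong: if_cong)

lemma scal_mult:
  assumes f: "f \<in> carrier R"
  shows "scal M c \<otimes>\<^bsub>R\<^esub> f = (\<lambda>m. c * f m)" "f \<otimes>\<^bsub>R\<^esub> scal M c = (\<lambda>m. c * f m)"
proof -
  have "(\<Sum>y\<in>carrier M. f y * (if y = m then 1 else 0)) = f m" for m
    using f finite_carrier by (auto simp: carrier_iff if_distrib[of "\<lambda>x. _ * x"] cong: if_cong)
  then have "c * (\<Sum>y\<in>carrier M. f y * (if y = m then 1 else 0)) = c * f m" for m by simp
  moreover have "(\<Sum>y\<in>carrier M. f y * (if y = m then c else 0)) = c * (\<Sum>y\<in>carrier M. f y * (if y = m then 1 else 0))" for m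
    unfolding sum_distrib_left by (intro sum.cong) auto
  ultimately have *: "(\<Sum>y\<in>carrier M. f y * (if y = m then c else 0)) = c * f m" for m by simp
  show "scal M c \<otimes>\<^bsub>R\<^esub> f = (\<lambda>m. c * f m)"
  proof
    fix m
    have "(scal M c \<otimes>\<^bsub>R\<^esub> f) m = (\<Sum>y\<in>carrier M. f y * (if y = m then c else 0))"
      unfolding mult_eq_lin(1)[OF scal_closed f] by (intro sum.cong refl) simp
    then show "(scal M c \<otimes>\<^bsub>R\<^esub> f) m = c * f m" by (simp only: *)
  qed
  show "f \<otimes>\<^bsub>R\<^esub> scal M c = (\<lambda>m. c * f m)"
  proof
    fix m
    have "(f \<otimes>\<^bsub>R\<^esub> scal M c) m = (\<Sum>y\<in>carrier M. f y * (if y = m then c else 0))"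
      unfolding mult_eq_lin(2)[OF f scal_closed] by (intro sum.cong refl) simp
    then show "(f \<otimes>\<^bsub>R\<^esub> scal M c) m = c * f m" by (simp only: *)
  qed
qed

lemma ring_monoid_algebra: "ring (R :: ('m \<Rightarrow> 'k::field) ring)"
proof (rule ringI)
  show "abelian_group (R :: ('m \<Rightarrow> 'k) ring)"
  proof (rule abelian_groupI)
    fix f :: "'m \<Rightarrow> 'k" assume "f \<in> carrier R"
    then show "\<exists>g\<in>carrier R. g \<oplus>\<^bsub>R\<^esub> f = \<zero>\<^bsub>R\<^esub>"
      by (intro bexI[of _ "\<lambda>m. - f m"]) (auto simp: carrier_iff add_apply zero_apply)
  qed (auto simp: carrier_iff add_apply zero_apply ac_simps)
  have one: "\<one>\<^bsub>R\<^esub> = (scal M 1 :: 'm \<Rightarrow> 'k)" by (simp add: one_apply scal_eq)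
  show "monoid (R :: ('m \<Rightarrow> 'k) ring)"
    by (rule monoidI) (simp_all add: mult_closed mult_assoc one scal_mult)
  fix f g h :: "'m \<Rightarrow> 'k" assume *: "f \<in> carrier R" "g \<in> carrier R" "h \<in> carrier R"
  then have fg: "f \<oplus>\<^bsub>R\<^esub> g \<in> carrier R" by (auto simp: carrier_iff add_apply)
  show "(f \<oplus>\<^bsub>R\<^esub> g) \<otimes>\<^bsub>R\<^esub> h = f \<otimes>\<^bsub>R\<^esub> h \<oplus>\<^bsub>R\<^esub> g \<otimes>\<^bsub>R\<^esub> h"
  proof
    fix m
    have "((f \<oplus>\<^bsub>R\<^esub> g) \<otimes>\<^bsub>R\<^esub> h) m = (f \<otimes>\<^bsub>R\<^esub> h) m + (g \<otimes>\<^bsub>R\<^esub> h) m"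
      by (simp add: mult_eq_lin(1) * fg lin_add distrib_left sum.distrib)
    then show "((f \<oplus>\<^bsub>R\<^esub> g) \<otimes>\<^bsub>R\<^esub> h) m = (f \<otimes>\<^bsub>R\<^esub> h \<oplus>\<^bsub>R\<^esub> g \<otimes>\<^bsub>R\<^esub> h) m" by (simp add: add_apply)
  qed
  show "h \<otimes>\<^bsub>R\<^esub> (f \<oplus>\<^bsub>R\<^esub> g) = h \<otimes>\<^bsub>R\<^esub> f \<oplus>\<^bsub>R\<^esub> h \<otimes>\<^bsub>R\<^esub> g"
  proof
    fix m
    have "(h \<otimes>\<^bsub>R\<^esub> (f \<oplus>\<^bsub>R\<^esub> g)) m = (h \<otimes>\<^bsub>R\<^esub> f) m + (h \<otimes>\<^bsub>R\<^esub> g) m"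
      by (simp add: mult_eq_lin(2) * fg lin_add distrib_left sum.distrib)
    then show "(h \<otimes>\<^bsub>R\<^esub> (f \<oplus>\<^bsub>R\<^esub> g)) m = (h \<otimes>\<^bsub>R\<^esub> f \<oplus>\<^bsub>R\<^esub> h \<otimes>\<^bsub>R\<^esub> g) m" by (simp add: add_apply)
  qed
qed

lemma minus_apply:
  assumes "f \<in> carrier R" "g \<in> carrier R"
  shows "f \<ominus>\<^bsub>R\<^esub> g = (\<lambda>m. f m - g m)"
proof -
  interpret ring R by (rule ring_monoid_algebra)
  have g': "(\<lambda>m. - g m) \<in> carrier R" using assms by (auto simp: carrier_iff)
  have "\<ominus>\<^bsub>R\<^esub> g = (\<lambda>m. - g m)"
    using assms g' by (intro minus_equality) (auto simp: add_apply zero_apply)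
  then show ?thesis by (simp add: a_minus_def add_apply)
qed

lemma finite_dimension_monoid_algebra:
  "ring.finite_dimension R (range (scal M)) (carrier (R :: ('m \<Rightarrow> 'k::field) ring))"
proof -
  interpret ring "R :: ('m \<Rightarrow> 'k) ring" by (rule ring_monoid_algebra)
  define F :: "'m set \<Rightarrow> ('m \<Rightarrow> 'k) set" where "F T = {f. \<forall>m. m \<notin> T \<longrightarrow> f m = 0}" for T
  have "dimension (card T) (range (scal M)) (F T)" if "finite T" "T \<subseteq> carrier M" for T
    using that
  proof (induction T rule: finite_induct)
    case empty
    have "F {} = {\<zero>\<^bsub>R\<^esub>}" by (auto simp: F_def zero_apply)
    then show ?case by simp
  next
    case (insert t T)
    have "F (insert t T) = line_extension (range (scal M)) (single t) (F T)"
    proof (rule Set.set_eqI)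
      fix f
      have "f \<in> F (insert t T) \<longleftrightarrow> (\<exists>c. \<exists>g\<in>F T. f = (\<lambda>m. c * single t m + g m))"
      proof
        assume f: "f \<in> F (insert t T)"
        have "f = (\<lambda>m. f t * single t m + (f(t := 0)) m)" by (auto simp: single_def)
        moreover have "f(t := 0) \<in> F T" using f by (auto simp: F_def)
        ultimately show "\<exists>c. \<exists>g\<in>F T. f = (\<lambda>m. c * single t m + g m)" by blast
      qed (auto simp: F_def single_def)
      then show "f \<in> F (insert t T) \<longleftrightarrow> f \<in> line_extension (range (scal M)) (single t) (F T)"
        using insert.prems by (simp add: line_extension_mem_iff scal_mult add_apply)
    qed
    moreover have "single t \<notin> F T" using insert by (auto simp: F_def single_def)
    ultimately show ?case using insert by (auto intro!: Suc_dim)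
  qed
  moreover have "F (carrier M) = carrier R" by (auto simp: F_def carrier_iff)
  ultimately have "dimension (card (carrier M)) (range (scal M)) (carrier R)"
    using finite_carrier by (metis order_refl)
  then show ?thesis by (auto simp: finite_dimension_def)
qed

text \<open>
  The element \<open>f\<close> has zero diagonal for the left action on monoid elements, and off the diagonal
  that action raises the rank, so \<open>f\<close> moves every filtration step into the next.
\<close>
lemma mult_support_rank:
  fixes \<rho> :: "'m \<Rightarrow> nat"
  assumes rank: "\<And>x m. x \<in> carrier M \<Longrightarrow> m \<in> carrier M \<Longrightarrow> x \<otimes> m = m \<or> \<rho> (x \<otimes> m) > \<rho> m"
    and f: "f \<in> carrier R" and g: "g \<in> carrier R"
    and fix0: "\<And>m. m \<in> carrier M \<Longrightarrow> lin (\<lambda>x. if x \<otimes> m = m then 1 else 0) f = 0"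
    and g0: "\<And>m. \<rho> m < k \<Longrightarrow> g m = 0" and m: "\<rho> m < Suc k"
  shows "(f \<otimes>\<^bsub>R\<^esub> g) m = 0"
  unfolding mult_eq_lin(1)[OF f g]
proof (rule sum.neutral, rule ballI)
  fix y assume y: "y \<in> carrier M"
  show "g y * lin (\<lambda>x. if x \<otimes> y = m then 1 else 0) f = 0"
  proof (cases "\<rho> y < k \<or> y = m")
    case True
    then show ?thesis using g0 fix0[of y] y by auto
  next
    case False
    have "x \<otimes> y \<noteq> m" if "x \<in> carrier M" for x
      using rank[OF that y] False m by auto
    then have "lin (\<lambda>x. if x \<otimes> y = m then 1 else 0) f = 0"
      unfolding lin_def by (intro sum.neutral) auto
    then show ?thesis by simp
  qed
qed

lemma nilpotent_of_rank:
  fixes \<rho> :: "'m \<Rightarrow> nat" and f :: "'m \<Rightarrow> 'k::field"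
  assumes rank: "\<And>x m. x \<in> carrier M \<Longrightarrow> m \<in> carrier M \<Longrightarrow> x \<otimes> m = m \<or> \<rho> (x \<otimes> m) > \<rho> m"
    and f: "f \<in> carrier R"
    and fix0: "\<And>m. m \<in> carrier M \<Longrightarrow> lin (\<lambda>x. if x \<otimes> m = m then 1 else 0) f = 0"
  shows "\<exists>n::nat. f [^]\<^bsub>R\<^esub> n = \<zero>\<^bsub>R\<^esub>"
proof -
  interpret ring "R :: ('m \<Rightarrow> 'k) ring" by (rule ring_monoid_algebra)
  have *: "(f [^]\<^bsub>R\<^esub> n) m = 0" if "\<rho> m < n" for n m
    using that
  proof (induction n arbitrary: m)
    case (Suc n)
    have "f [^]\<^bsub>R\<^esub> n \<in> carrier R" using f by (rule nat_pow_closed)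
    then have "(f \<otimes>\<^bsub>R\<^esub> f [^]\<^bsub>R\<^esub> n) m = 0"
      using rank f fix0 Suc by (intro mult_support_rank[where k = n and \<rho> = \<rho>]) auto
    then show ?case using f by (simp only: nat_pow_Suc2)
  qed simp
  define n where "n = Suc (\<Sum>m\<in>carrier M. \<rho> m)"
  have "(f [^]\<^bsub>R\<^esub> n) m = 0" for m
  proof (cases "m \<in> carrier M")
    case True
    then have "\<rho> m < n" using finite_carrier by (simp add: n_def less_Suc_eq_le member_le_sum)
    then show ?thesis by (rule *)
  next
    case False
    then show ?thesis using nat_pow_closed[OF f, of n] by (simp add: carrier_iff)
  qed
  then show ?thesis by (intro exI[of _ n]) (auto simp: zero_apply)
qed

end

section \<open>The action of letters on columns\<close>

text \<open>
  An element \<open>t \<ge> a\<close> survives unless it is the least such element, that is, iff another element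
  lies in between. This turns identities between actions into first-order statements about the
  order.
\<close>
lemma left_act_iff:
  assumes "finite \<gamma>"
  shows "t \<in> left_act a \<gamma> \<longleftrightarrow> t = a \<or> t \<in> \<gamma> \<and> (t < a \<or> (\<exists>s\<in>\<gamma>. a \<le> s \<and> s < t))"
proof (cases "\<forall>y\<in>\<gamma>. a > y")
  case True
  then show ?thesis by (auto simp: left_act_def)
next
  case False
  let ?S = "{y \<in> \<gamma>. y \<ge> a}"
  have "finite ?S" "?S \<noteq> {}" using assms False by (auto simp: not_less)
  then have m: "Min ?S \<in> ?S" "\<And>s. s \<in> ?S \<Longrightarrow> Min ?S \<le> s" by (auto simp del: mem_Collect_eq intro: Min_in)
  have "t \<noteq> Min ?S \<longleftrightarrow> t < a \<or> (\<exists>s\<in>\<gamma>. a \<le> s \<and> s < t)" if "t \<in> \<gamma>"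
  proof
    assume "t \<noteq> Min ?S"
    then show "t < a \<or> (\<exists>s\<in>\<gamma>. a \<le> s \<and> s < t)" using m(1) m(2)[of t] that by force
  next
    assume "t < a \<or> (\<exists>s\<in>\<gamma>. a \<le> s \<and> s < t)"
    then show "t \<noteq> Min ?S" using m by force
  qed
  then show ?thesis using False by (auto simp: left_act_def)
qed

lemma finite_left_act [simp]: "finite \<gamma> \<Longrightarrow> finite (left_act a \<gamma>)"
  by (simp add: left_act_def)

lemma left_act_subset: "\<gamma> \<subseteq> A \<Longrightarrow> a \<in> A \<Longrightarrow> left_act a \<gamma> \<subseteq> A"
  by (auto simp: left_act_def)

lemma left_act_member:
  assumes "finite \<gamma>" "a \<in> \<gamma>" shows "left_act a \<gamma> = \<gamma>"
  using assms by (auto simp: left_act_iff) (metis linorder_neqE order_refl)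

text \<open>
  The letter \<open>x\<close> bumps an element at most \<open>p\<close>, hence below \<open>z\<close>, while \<open>z\<close> bumps one that is at
  least \<open>z\<close>: the two letters do not interfere.
\<close>
lemma left_act_commute:
  assumes fin: "finite \<gamma>" and p: "p \<in> \<gamma>" "x \<le> p" "p < z"
  shows "left_act x (left_act z \<gamma>) = left_act z (left_act x \<gamma>)"
proof (rule Set.set_eqI)
  fix t
  have z: "t \<in> left_act z \<gamma> \<longleftrightarrow> t \<in> \<gamma>" if "t < z" for t using fin that by (auto simp: left_act_iff)
  have x: "t \<in> left_act x \<gamma> \<longleftrightarrow> t \<in> \<gamma>" if "z \<le> t" for t
    using fin p that by (auto simp: left_act_iff)
  have "x < z" using p by order
  show "t \<in> left_act x (left_act z \<gamma>) \<longleftrightarrow> t \<in> left_act z (left_act x \<gamma>)"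
  proof (cases "t < z")
    case True
    then have "t \<in> left_act x (left_act z \<gamma>) \<longleftrightarrow> t \<in> left_act x \<gamma>"
      using fin z by (auto simp: left_act_iff[of "left_act z \<gamma>"] left_act_iff[of \<gamma> t x])
    moreover have "t \<in> left_act z (left_act x \<gamma>) \<longleftrightarrow> t \<in> left_act x \<gamma>"
      using fin True by (auto simp: left_act_iff[of "left_act x \<gamma>"])
    ultimately show ?thesis by simp
  next
    case False
    have "p \<in> left_act z \<gamma>" using z p by simp
    then have "t \<in> left_act x (left_act z \<gamma>) \<longleftrightarrow> t \<in> left_act z \<gamma>"
      using fin p False \<open>x < z\<close> by (auto simp: left_act_iff[of "left_act z \<gamma>"])
    moreover have "t \<in> left_act z (left_act x \<gamma>) \<longleftrightarrow> t \<in> left_act z \<gamma>"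
      using fin x False by (auto simp: left_act_iff[of "left_act x \<gamma>"] left_act_iff[of \<gamma> t z])
    ultimately show ?thesis by simp
  qed
qed

text \<open>
  Without elements in \<open>[y, z)\<close>, both letters bump the same element, and \<open>y\<close> then bumps the \<open>z\<close>
  that was inserted. For \<open>y = z\<close> this is idempotence.
\<close>
lemma left_act_absorb:
  assumes fin: "finite \<gamma>" and "y \<le> z" and gap: "\<And>s. s \<in> \<gamma> \<Longrightarrow> y \<le> s \<Longrightarrow> z \<le> s"
  shows "left_act y (left_act z \<gamma>) = left_act y \<gamma>"
proof (rule Set.set_eqI)
  fix t
  have Lz: "z \<in> left_act z \<gamma>" using fin by (simp add: left_act_iff)
  show "t \<in> left_act y (left_act z \<gamma>) \<longleftrightarrow> t \<in> left_act y \<gamma>"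
  proof
    assume "t \<in> left_act y (left_act z \<gamma>)"
    then consider "t = y" | "t \<in> left_act z \<gamma>" "t < y" | s where "t \<in> left_act z \<gamma>" "s \<in> left_act z \<gamma>" "y \<le> s" "s < t"
      using fin by (auto simp: left_act_iff[of "left_act z \<gamma>"])
    then show "t \<in> left_act y \<gamma>"
    proof cases
      case 3
      then have "z \<le> s" using gap fin by (auto simp: left_act_iff)
      then obtain s0 where "t \<in> \<gamma>" "s0 \<in> \<gamma>" "z \<le> s0" "s0 < t"
        using 3 fin by (auto simp: left_act_iff)
      then show ?thesis using fin \<open>y \<le> z\<close> by (auto simp: left_act_iff)
    qed (use fin \<open>y \<le> z\<close> in \<open>auto simp: left_act_iff\<close>)
  next
    assume "t \<in> left_act y \<gamma>"
    then consider "t = y" | "t \<in> \<gamma>" "t < y" | s where "t \<in> \<gamma>" "s \<in> \<gamma>" "y \<le> s" "s < t"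
      using fin by (auto simp: left_act_iff)
    then show "t \<in> left_act y (left_act z \<gamma>)"
    proof cases
      case 3
      then have "z \<le> s" using gap by blast
      then have "t \<in> left_act z \<gamma>" "z < t" using 3 fin by (auto simp: left_act_iff)
      then show ?thesis using Lz fin \<open>y \<le> z\<close> by (auto simp: left_act_iff[of "left_act z \<gamma>"])
    qed (use fin \<open>y \<le> z\<close> in \<open>auto simp: left_act_iff[of "left_act z \<gamma>"] left_act_iff[of \<gamma> t z]\<close>)
  qed
qed

lemma left_act_idem: "finite \<gamma> \<Longrightarrow> left_act a (left_act a \<gamma>) = left_act a \<gamma>"
  by (rule left_act_absorb) auto

lemma left_act_knuth1:
  assumes "finite \<gamma>" "x \<le> y" "y < z"
  shows "left_act x (left_act z (left_act y \<gamma>)) = left_act z (left_act x (left_act y \<gamma>))"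
  using assms by (intro left_act_commute[where p = y]) (auto simp: left_act_iff)

text \<open>
  If \<open>[x, z)\<close> meets the column, then \<open>x\<close> and \<open>z\<close> commute on it. If not, both sides absorb \<open>z\<close>:
  on the left it is absorbed by \<open>x\<close>, on the right by \<open>y\<close>.
\<close>
lemma left_act_knuth2:
  assumes fin: "finite \<gamma>" and "x < y" "y \<le> z"
  shows "left_act y (left_act x (left_act z \<gamma>)) = left_act y (left_act z (left_act x \<gamma>))"
proof (cases "\<exists>p\<in>\<gamma>. x \<le> p \<and> p < z")
  case True
  then show ?thesis using left_act_commute[OF fin] by metis
next
  case False
  then have "left_act x (left_act z \<gamma>) = left_act x \<gamma>"
    using assms by (intro left_act_absorb) (auto simp: not_less)
  moreover have "left_act y (left_act z (left_act x \<gamma>)) = left_act y (left_act x \<gamma>)"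
  proof (rule left_act_absorb)
    fix s assume "s \<in> left_act x \<gamma>" "y \<le> s"
    then show "z \<le> s" using False assms by (force simp: left_act_iff not_less)
  qed (use assms in auto)
  ultimately show ?thesis by simp
qed

text \<open>
  The weight of \<open>i\<close> is positive and decreases with \<open>i\<close>, so adding an element and replacing an
  element by a smaller one both raise the rank.
\<close>
definition column_rank :: "'a::linorder set \<Rightarrow> 'a set \<Rightarrow> nat" where
  "column_rank A \<gamma> = (\<Sum>i\<in>\<gamma>. card {y \<in> A. i \<le> y})"

lemma left_act_rank:
  assumes A: "finite A" and \<gamma>: "\<gamma> \<subseteq> A" and a: "a \<in> A"
  shows "left_act a \<gamma> = \<gamma> \<or> column_rank A \<gamma> < column_rank A (left_act a \<gamma>)"
proof -
  have fin: "finite \<gamma>" using A \<gamma> by (rule finite_subset[rotated])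
  have pos: "card {y \<in> A. a \<le> y} > 0" using A a by (auto simp: card_gt_0_iff)
  consider "a \<in> \<gamma>" | "a \<notin> \<gamma>" "\<forall>y\<in>\<gamma>. a > y" | "a \<notin> \<gamma>" "\<not> (\<forall>y\<in>\<gamma>. a > y)" by blast
  then show ?thesis
  proof cases
    case 1
    then show ?thesis using left_act_member[OF fin] by simp
  next
    case 2
    then have "left_act a \<gamma> = insert a \<gamma>" by (simp add: left_act_def)
    then show ?thesis using 2 fin pos by (simp add: column_rank_def)
  next
    case 3
    define b where "b = Min {y \<in> \<gamma>. y \<ge> a}"
    have "b \<in> {y \<in> \<gamma>. y \<ge> a}" unfolding b_def using 3 fin by (intro Min_in) (auto simp: not_less)
    then have b: "b \<in> \<gamma>" "a < b" using 3 by (auto simp: order_le_less)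
    have "left_act a \<gamma> = insert a (\<gamma> - {b})" by (simp only: left_act_def 3(2) if_False b_def) simp
    then have "column_rank A (left_act a \<gamma>) = card {y \<in> A. a \<le> y} + column_rank A (\<gamma> - {b})"
      using 3 fin by (simp add: column_rank_def)
    moreover have "column_rank A \<gamma> = card {y \<in> A. b \<le> y} + column_rank A (\<gamma> - {b})"
      unfolding column_rank_def using b fin by (simp add: sum.remove)
    moreover have "a \<notin> {y \<in> A. b \<le> y}" "a \<in> {y \<in> A. a \<le> y}" "{y \<in> A. b \<le> y} \<subseteq> {y \<in> A. a \<le> y}"
      using a b by auto
    then have "card {y \<in> A. b \<le> y} < card {y \<in> A. a \<le> y}"
      using A by (intro psubset_card_mono) auto
    ultimately show ?thesis by simp
  qed
qed

text \<open>
  The derivation on words with value \<open>1\<close> on the letter \<open>z\<close> and \<open>0\<close> on the others, where a word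
  acts from the left by \<open>1\<close> if its letters lie in \<open>B\<close> and by \<open>0\<close> otherwise, and from the right
  in the same way with \<open>C\<close>: the number of occurrences of \<open>z\<close> preceded by letters of \<open>B\<close> only and
  followed by letters of \<open>C\<close> only.
\<close>
fun cross :: "'a set \<Rightarrow> 'a set \<Rightarrow> 'a \<Rightarrow> 'a list \<Rightarrow> 'k::field" where
  "cross B C z [] = 0"
| "cross B C z (a # w) = (if a \<in> B then cross B C z w else 0) + (if a = z \<and> set w \<subseteq> C then 1 else 0)"

lemma cross_append:
  "cross B C z (u @ v) = (if set u \<subseteq> B then cross B C z v else 0) + (if set v \<subseteq> C then cross B C z u else 0)"
  by (induction u) auto

section \<open>The stylic monoid\<close>

locale stylic =
  fixes A :: "'a::linorder set"
  assumes A: "finite A"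
begin

abbreviation "act \<equiv> left_act_word"

lemma act_Nil [simp]: "act [] \<gamma> = \<gamma>" and act_Cons [simp]: "act (a # w) \<gamma> = left_act a (act w \<gamma>)"
  and act_append: "act (u @ v) \<gamma> = act u (act v \<gamma>)"
  by (simp_all add: left_act_word_def)

lemma act_subset: "w \<in> lists A \<Longrightarrow> \<gamma> \<subseteq> A \<Longrightarrow> act w \<gamma> \<subseteq> A"
  by (induction w) (auto dest: left_act_subset)

lemma finite_act: "w \<in> lists A \<Longrightarrow> \<gamma> \<subseteq> A \<Longrightarrow> finite (act w \<gamma>)"
  using finite_subset[OF act_subset A] .

definition below :: "'a \<Rightarrow> 'a set" where
  "below b = {y \<in> A. y < b}"

lemma below_subset [simp]: "below b \<subseteq> A"
  by (auto simp: below_def)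

text \<open>
  Once all of \<open>{y. y < b}\<close> is present, the letters below \<open>b\<close> do nothing, and those above \<open>b\<close>
  neither insert nor bump \<open>b\<close>. So \<open>b\<close> appears exactly when the letter \<open>b\<close> acts, and it stays.
\<close>
lemma act_below:
  assumes w: "w \<in> lists A"
  shows "below b \<subseteq> act w (below b) \<and> (b \<in> act w (below b) \<longleftrightarrow> b \<in> set w)"
  using w
proof (induction w)
  case Nil
  then show ?case by (simp add: below_def)
next
  case (Cons a w)
  let ?g = "act w (below b)"
  have fin: "finite ?g" using Cons by (intro finite_act) auto
  have IH: "below b \<subseteq> ?g" "b \<in> ?g \<longleftrightarrow> b \<in> set w" using Cons by auto
  show ?case
  proof (cases "a < b")
    case True
    then have "a \<in> ?g" using IH(1) Cons.hyps by (auto simp: below_def)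
    then show ?thesis using left_act_member[OF fin] IH True by auto
  next
    case False
    then show ?thesis using IH fin by (auto simp: left_act_iff below_def)
  qed
qed

text \<open>The set of letters of any word inducing \<open>m\<close> (\<open>content_stylic_map\<close>).\<close>
definition content :: "('a set \<Rightarrow> 'a set) \<Rightarrow> 'a set" where
  "content m = {b \<in> A. b \<in> m (below b)}"

abbreviation "\<mu> \<equiv> stylic_map A"

lemma stylic_map_apply: "\<gamma> \<subseteq> A \<Longrightarrow> \<mu> w \<gamma> = act w \<gamma>"
  by (simp add: stylic_map_def columns_def)

lemma content_stylic_map: "w \<in> lists A \<Longrightarrow> content (\<mu> w) = set w"
  using act_below by (auto simp: content_def stylic_map_apply)

lemma stylic_map_eqI: "(\<And>\<gamma>. \<gamma> \<subseteq> A \<Longrightarrow> act u \<gamma> = act v \<gamma>) \<Longrightarrow> \<mu> u = \<mu> v"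
  by (auto simp: stylic_map_def columns_def restrict_def fun_eq_iff)

lemma Styl_mult: "v \<in> lists A \<Longrightarrow> \<mu> u \<otimes>\<^bsub>Styl A\<^esub> \<mu> v = \<mu> (u @ v)"
  using act_subset by (auto simp: Styl_def stylic_map_def compose_def columns_def act_append restrict_def fun_eq_iff)

lemma Styl_one: "\<one>\<^bsub>Styl A\<^esub> = \<mu> []"
  by (auto simp: Styl_def stylic_map_def restrict_def fun_eq_iff)

lemma Styl_carrier: "carrier (Styl A) = \<mu> ` lists A"
  by (simp add: Styl_def)

lemma Styl_cases:
  assumes "m \<in> carrier (Styl A)"
  obtains w where "w \<in> lists A" "m = \<mu> w"
  using assms by (auto simp: Styl_carrier)

lemma stylic_map_closed [simp]: "w \<in> lists A \<Longrightarrow> \<mu> w \<in> carrier (Styl A)"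
  by (simp add: Styl_carrier)

lemma monoid_Styl: "monoid (Styl A)"
proof (rule monoidI)
  fix x y z assume "x \<in> carrier (Styl A)" "y \<in> carrier (Styl A)" "z \<in> carrier (Styl A)"
  then obtain u v w where *: "u \<in> lists A" "v \<in> lists A" "w \<in> lists A" "x = \<mu> u" "y = \<mu> v" "z = \<mu> w"
    by (metis Styl_cases)
  show "x \<otimes>\<^bsub>Styl A\<^esub> y \<in> carrier (Styl A)"
    and "x \<otimes>\<^bsub>Styl A\<^esub> y \<otimes>\<^bsub>Styl A\<^esub> z = x \<otimes>\<^bsub>Styl A\<^esub> (y \<otimes>\<^bsub>Styl A\<^esub> z)"
    using * by (simp_all add: Styl_mult)
  show "\<one>\<^bsub>Styl A\<^esub> \<otimes>\<^bsub>Styl A\<^esub> x = x" "x \<otimes>\<^bsub>Styl A\<^esub> \<one>\<^bsub>Styl A\<^esub> = x"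
    using * by (simp_all add: Styl_one Styl_mult)
qed (simp add: Styl_one)

lemma finite_Styl: "finite (carrier (Styl A))"
proof (rule finite_subset)
  show "carrier (Styl A) \<subseteq> Pow A \<rightarrow>\<^sub>E Pow A"
  proof
    fix m assume "m \<in> carrier (Styl A)"
    then obtain w where w: "w \<in> lists A" "m = \<mu> w" by (rule Styl_cases)
    show "m \<in> Pow A \<rightarrow>\<^sub>E Pow A"
      using act_subset[OF w(1)] by (auto simp: w(2) stylic_map_def columns_def PiE_iff)
  qed
  show "finite (Pow A \<rightarrow>\<^sub>E Pow A)" using A by (intro finite_PiE) auto
qed

lemma content_mult:
  assumes "x \<in> carrier (Styl A)" "y \<in> carrier (Styl A)"
  shows "content (x \<otimes>\<^bsub>Styl A\<^esub> y) = content x \<union> content y"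
proof -
  from assms obtain u v where "u \<in> lists A" "v \<in> lists A" "x = \<mu> u" "y = \<mu> v" by (metis Styl_cases)
  then show ?thesis by (simp add: Styl_mult content_stylic_map)
qed

definition map_rank :: "('a set \<Rightarrow> 'a set) \<Rightarrow> nat" where
  "map_rank m = (\<Sum>\<gamma>\<in>Pow A. column_rank A (m \<gamma>))"

lemma map_rank_letter:
  assumes a: "a \<in> A" and v: "v \<in> lists A"
  shows "\<mu> (a # v) = \<mu> v \<or> map_rank (\<mu> v) < map_rank (\<mu> (a # v))"
proof (rule disjCI)
  assume "\<not> map_rank (\<mu> v) < map_rank (\<mu> (a # v))"
  then have le: "map_rank (\<mu> (a # v)) \<le> map_rank (\<mu> v)" by simp
  have step: "act (a # v) \<gamma> = act v \<gamma> \<or> column_rank A (act v \<gamma>) < column_rank A (act (a # v) \<gamma>)" if "\<gamma> \<subseteq> A" for \<gamma>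
    using left_act_rank[OF A act_subset[OF v that] a] by simp
  have "act (a # v) \<gamma> = act v \<gamma>" if g: "\<gamma> \<subseteq> A" for \<gamma>
  proof (rule ccontr)
    assume "act (a # v) \<gamma> \<noteq> act v \<gamma>"
    then have "column_rank A (act v \<gamma>) < column_rank A (act (a # v) \<gamma>)" using step[OF g] by blast
    moreover have "column_rank A (act v \<gamma>) \<le> column_rank A (act (a # v) \<gamma>)" if "\<gamma> \<in> Pow A" for \<gamma>
      using step[of \<gamma>] that by (metis PowD less_imp_le order_refl)
    ultimately have "(\<Sum>\<gamma>\<in>Pow A. column_rank A (act v \<gamma>)) < (\<Sum>\<gamma>\<in>Pow A. column_rank A (act (a # v) \<gamma>))"
      using A g by (intro sum_strict_mono_ex1) blast+
    then show False using le by (simp add: map_rank_def stylic_map_apply)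
  qed
  then show "\<mu> (a # v) = \<mu> v" by (rule stylic_map_eqI)
qed

text \<open>
  As ranks never drop, a word fixes an element under left multiplication only if each of its
  letters does.
\<close>
lemma map_rank_word:
  assumes w: "w \<in> lists A" and v: "v \<in> lists A"
  shows "\<mu> (w @ v) = \<mu> v \<and> (\<forall>a\<in>set w. \<mu> (a # v) = \<mu> v) \<or>
    map_rank (\<mu> v) < map_rank (\<mu> (w @ v)) \<and> \<not> (\<forall>a\<in>set w. \<mu> (a # v) = \<mu> v)"
  using w
proof (induction w)
  case (Cons a w)
  have c: "\<mu> (a # w @ v) = \<mu> (a # v)" if "\<mu> (w @ v) = \<mu> v"
    using Styl_mult[of "w @ v" "[a]"] Styl_mult[of v "[a]"] that Cons v by simp
  have wv: "w @ v \<in> lists A" and a: "a \<in> A" using Cons v by auto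
  from Cons.IH show ?case
  proof
    assume IH: "\<mu> (w @ v) = \<mu> v \<and> (\<forall>a\<in>set w. \<mu> (a # v) = \<mu> v)"
    then show ?case using map_rank_letter[OF a v] c by (metis append_Cons less_irrefl list.set_intros(1) set_ConsD)
  next
    assume IH: "map_rank (\<mu> v) < map_rank (\<mu> (w @ v)) \<and> \<not> (\<forall>a\<in>set w. \<mu> (a # v) = \<mu> v)"
    then have "map_rank (\<mu> v) < map_rank (\<mu> ((a # w) @ v))"
      using map_rank_letter[OF a wv] by (metis append_Cons less_trans)
    then show ?case using IH by (meson list.set_intros(2))
  qed
qed simp

lemma Styl_rank:
  assumes "x \<in> carrier (Styl A)" "m \<in> carrier (Styl A)"
  shows "x \<otimes>\<^bsub>Styl A\<^esub> m = m \<or> map_rank m < map_rank (x \<otimes>\<^bsub>Styl A\<^esub> m)"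
proof -
  from assms obtain u v where "u \<in> lists A" "v \<in> lists A" "x = \<mu> u" "m = \<mu> v" by (metis Styl_cases)
  then show ?thesis using map_rank_word[of u v] by (auto simp: Styl_mult)
qed

definition stabiliser :: "('a set \<Rightarrow> 'a set) \<Rightarrow> 'a set" where
  "stabiliser m = {a \<in> A. \<mu> [a] \<otimes>\<^bsub>Styl A\<^esub> m = m}"

text \<open>
  Hence the diagonal entries of left multiplication are values of the characters attached to sets
  of letters.
\<close>
lemma Styl_fixes_iff:
  assumes "x \<in> carrier (Styl A)" "m \<in> carrier (Styl A)"
  shows "x \<otimes>\<^bsub>Styl A\<^esub> m = m \<longleftrightarrow> content x \<subseteq> stabiliser m"
proof -
  from assms obtain u v where uv: "u \<in> lists A" "v \<in> lists A" "x = \<mu> u" "m = \<mu> v" by (metis Styl_cases)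
  then have "(\<forall>a\<in>set u. \<mu> (a # v) = \<mu> v) \<longleftrightarrow> content x \<subseteq> stabiliser m"
    by (auto simp: content_stylic_map stabiliser_def Styl_mult)
  then show ?thesis using map_rank_word[OF uv(1,2)] uv by (auto simp: Styl_mult)
qed

section \<open>A derivation of the stylic monoid\<close>

text \<open>
  The map on the stylic monoid induced by \<open>cross B C z\<close> for \<open>C = insert z (B - {x})\<close>. It detects
  that the letters lie in \<open>insert z B\<close>, that \<open>z\<close> occurs, and that no \<open>z\<close> occurs to the left of an
  \<open>x\<close>. The last condition is visible in the action on \<open>{y. y < x}\<close>: when \<open>x\<close> first acts, it
  removes a \<open>z\<close> that is already there, and only a \<open>z\<close> acting later survives next to \<open>x\<close>.
\<close>
definition crossing :: "'a set \<Rightarrow> 'a \<Rightarrow> 'a \<Rightarrow> ('a set \<Rightarrow> 'a set) \<Rightarrow> 'k::field" where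
  "crossing B x z m = (if content m \<subseteq> insert z B \<and> z \<in> content m \<and> \<not> {x, z} \<subseteq> m (below x) then 1 else 0)"

text \<open>
  This is what makes \<open>cross\<close> depend only on the map induced by the word. The induction also
  carries along that the open interval from \<open>x\<close> to \<open>z\<close> stays empty, so that \<open>x\<close> indeed bumps \<open>z\<close>.
\<close>
lemma crossing_stylic_map:
  assumes w: "w \<in> lists A" and B: "x \<in> B" "z \<in> A" "z \<notin> B" "x < z" "B \<inter> {x<..<z} = {}"
  shows "(crossing B x z (\<mu> w) :: 'k::field) = cross B (insert z (B - {x})) z w"
proof -
  have "(cross B (insert z (B - {x})) z w :: 'k) =
     (if set w \<subseteq> insert z B \<and> z \<in> set w \<and> \<not> {x, z} \<subseteq> act w (below x) then 1 else 0) \<and>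
     (set w \<subseteq> insert z B \<longrightarrow> act w (below x) \<inter> {x<..<z} = {})"
    (is "?P w")
    using w
  proof (induction w)
    case Nil
    then show ?case by (auto simp: below_def)
  next
    case (Cons a w)
    let ?g = "act w (below x)"
    have w: "w \<in> lists A" using Cons by auto
    have fin: "finite ?g" using finite_act[OF w] by simp
    have sub: "below x \<subseteq> ?g" and x: "x \<in> ?g \<longleftrightarrow> x \<in> set w" using act_below[OF w] by auto
    show ?case
    proof (cases "set (a # w) \<subseteq> insert z B")
      case False
      then consider "a \<notin> insert z B" | "a \<in> insert z B" "\<not> set w \<subseteq> insert z B" by auto
      then show ?thesis
      proof cases
        case 2
        then have "\<not> set w \<subseteq> insert z (B - {x})" by blast
        then show ?thesis using 2 Cons.IH by simp
      qed simp
    next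
      case True
      then have gap: "?g \<inter> {x<..<z} = {}" using Cons.IH by simp
      \<comment> \<open>a letter below \<open>x\<close> is already present, and one above \<open>z\<close> touches neither \<open>x\<close> nor \<open>z\<close>\<close>
      consider "a < x" | "a = x" | "a = z" | "z < a" using True B by force
      then show ?thesis
      proof cases
        case 1
        then have "a \<in> ?g" using sub Cons.hyps by (auto simp: below_def)
        moreover have "a \<in> B" "a \<noteq> z" using 1 B True by auto
        ultimately show ?thesis using Cons.IH left_act_member[OF fin] True by auto
      next
        case 2
        then have "left_act a ?g \<inter> {x<..<z} = {}" using gap fin by (auto simp: left_act_iff)
        moreover have "x \<in> left_act a ?g" "x \<in> ?g \<Longrightarrow> left_act a ?g = ?g" "x \<notin> ?g \<Longrightarrow> z \<notin> left_act a ?g"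
          using 2 fin gap B by (auto simp: left_act_iff left_act_member order_le_less)
        ultimately show ?thesis using Cons.IH 2 B True by auto
      next
        case 3
        then have "left_act a ?g \<inter> {x<..<z} = {}" "z \<in> left_act a ?g" "x \<in> left_act a ?g \<longleftrightarrow> x \<in> ?g"
          using gap fin B by (auto simp: left_act_iff)
        moreover have "set w \<subseteq> insert z (B - {x}) \<longleftrightarrow> x \<notin> set w" using True B by auto
        ultimately show ?thesis using 3 B True x by auto
      next
        case 4
        then have "t \<in> left_act a ?g \<longleftrightarrow> t \<in> ?g" if "t \<le> z" for t
          using fin that by (auto simp: left_act_iff)
        then have "left_act a ?g \<inter> {x<..<z} = {}" "{x, z} \<subseteq> left_act a ?g \<longleftrightarrow> {x, z} \<subseteq> ?g"
          using gap B(4) by (auto simp: disjoint_iff)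
        moreover have "a \<in> B" using True 4 by auto
        ultimately show ?thesis using Cons.IH 4 True by auto
      qed
    qed
  qed
  then show ?thesis using w by (simp add: crossing_def content_stylic_map stylic_map_apply)
qed

text \<open>The derivation property of \<open>cross\<close> on concatenations passes to the monoid.\<close>
lemma crossing_mult:
  assumes "m \<in> carrier (Styl A)" "m' \<in> carrier (Styl A)"
    and B: "x \<in> B" "z \<in> A" "z \<notin> B" "x < z" "B \<inter> {x<..<z} = {}"
  shows "(crossing B x z (m \<otimes>\<^bsub>Styl A\<^esub> m') :: 'k::field) =
    (if content m \<subseteq> B then crossing B x z m' else 0) +
    (if content m' \<subseteq> insert z (B - {x}) then crossing B x z m else 0)"
proof -
  from assms(1,2) obtain u v where uv: "u \<in> lists A" "v \<in> lists A" "m = \<mu> u" "m' = \<mu> v" by (metis Styl_cases)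
  then show ?thesis
    by (simp add: Styl_mult crossing_stylic_map[OF _ B] content_stylic_map cross_append)
qed

section \<open>Characters of the stylic algebra\<close>

sublocale M: finite_monoid "Styl A"
  by (intro finite_monoid.intro monoid_Styl finite_monoid_axioms.intro finite_Styl)

definition character :: "'a set \<Rightarrow> (('a set \<Rightarrow> 'a set) \<Rightarrow> 'k) \<Rightarrow> 'k::field" where
  "character B = M.lin (\<lambda>m. if content m \<subseteq> B then 1 else 0)"

lemma lin_cong: "(\<And>m. m \<in> carrier (Styl A) \<Longrightarrow> g m = h m) \<Longrightarrow> M.lin g f = M.lin h f"
  unfolding M.lin_def by (intro sum.cong) auto

lemma character_mult:
  assumes "f \<in> carrier M.R" "g \<in> carrier M.R"
  shows "character B (f \<otimes>\<^bsub>M.R\<^esub> g) = character B f * character B g"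
  unfolding character_def M.lin_mult[OF assms]
  unfolding M.lin_def sum_product
  by (intro sum.cong refl) (auto simp: content_mult)

lemma content_one: "content \<one>\<^bsub>Styl A\<^esub> = {}"
  by (simp add: Styl_one content_stylic_map)

text \<open>
  The common kernel is nil because the diagonal entry of left multiplication at \<open>m\<close> is the
  character of the stabiliser of \<open>m\<close>.
\<close>
lemma split_algebra_stylic:
  "split_algebra (M.R :: (('a set \<Rightarrow> 'a set) \<Rightarrow> 'k::field) ring) (scal (Styl A)) (Pow A) character"
proof -
  interpret R: ring "M.R :: (('a set \<Rightarrow> 'a set) \<Rightarrow> 'k) ring" by (rule M.ring_monoid_algebra)
  show ?thesis
  proof unfold_locales
    show "scal (Styl A) 1 = (\<one>\<^bsub>M.R\<^esub> :: ('a set \<Rightarrow> 'a set) \<Rightarrow> 'k)"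
      by (simp add: M.one_apply M.scal_eq)
    show "(\<one>\<^bsub>M.R\<^esub> :: ('a set \<Rightarrow> 'a set) \<Rightarrow> 'k) \<noteq> \<zero>\<^bsub>M.R\<^esub>"
      by (auto simp: M.one_apply M.zero_apply single_def fun_eq_iff)
    fix c d :: 'k
    show "scal (Styl A) c \<in> carrier M.R" by simp
    show "scal (Styl A) (c + d) = scal (Styl A) c \<oplus>\<^bsub>M.R\<^esub> scal (Styl A) d"
      by (auto simp: M.add_apply scal_def)
    show "scal (Styl A) (c * d) = scal (Styl A) c \<otimes>\<^bsub>M.R\<^esub> scal (Styl A) d"
      by (simp add: M.scal_mult) (auto simp: scal_def)
    show "scal (Styl A) c \<otimes>\<^bsub>M.R\<^esub> f = f \<otimes>\<^bsub>M.R\<^esub> scal (Styl A) c" if "f \<in> carrier M.R" for f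
      using that by (simp add: M.scal_mult)
    show "character B (scal (Styl A) c) = c" for B by (simp add: character_def content_one)
    show "character B (f \<oplus>\<^bsub>M.R\<^esub> g) = character B f + character B g" for B and f g :: "('a set \<Rightarrow> 'a set) \<Rightarrow> 'k"
      by (simp add: character_def M.lin_add)
    show "character B (f \<otimes>\<^bsub>M.R\<^esub> g) = character B f * character B g"
      if "f \<in> carrier M.R" "g \<in> carrier M.R" for B and f g :: "('a set \<Rightarrow> 'a set) \<Rightarrow> 'k"
      by (rule character_mult[OF that])
    show "\<exists>f\<in>carrier M.R. character B f \<noteq> (character C f :: 'k)" if BC: "B \<in> Pow A" "C \<in> Pow A" "B \<noteq> C" for B C
    proof -
      obtain a where a: "a \<in> A" "a \<in> B \<longleftrightarrow> a \<notin> C" using BC by blast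
      then have "character B (single (\<mu> [a])) \<noteq> (character C (single (\<mu> [a])) :: 'k)"
        by (auto simp: character_def content_stylic_map)
      then show ?thesis using a(1) by (intro bexI[of _ "single (\<mu> [a])"]) auto
    qed
    show "\<exists>n::nat. f [^]\<^bsub>M.R\<^esub> n = \<zero>\<^bsub>M.R\<^esub>"
      if f: "f \<in> carrier M.R" and chi: "\<And>B. B \<in> Pow A \<Longrightarrow> character B f = 0" for f :: "('a set \<Rightarrow> 'a set) \<Rightarrow> 'k"
    proof (rule M.nilpotent_of_rank[OF Styl_rank f])
      fix m assume m: "m \<in> carrier (Styl A)"
      have "M.lin (\<lambda>x. if x \<otimes>\<^bsub>Styl A\<^esub> m = m then 1 else 0) f = character (stabiliser m) f"
        unfolding character_def using Styl_fixes_iff m by (intro lin_cong) simp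
      then show "M.lin (\<lambda>x. if x \<otimes>\<^bsub>Styl A\<^esub> m = m then 1 else 0) f = 0"
        using chi[of "stabiliser m"] by (auto simp: stabiliser_def)
    qed
  qed (use A in simp)
qed

end

section \<open>Generators of the radical\<close>

text \<open>The parameter \<open>field_type\<close> only fixes the field of coefficients.\<close>
locale stylic_algebra = stylic A for A :: "'a::linorder set" +
  fixes field_type :: "'k::field itself"
begin

abbreviation R :: "(('a set \<Rightarrow> 'a set) \<Rightarrow> 'k) ring" where
  "R \<equiv> monoid_algebra (Styl A)"

sublocale alg: split_algebra R "scal (Styl A)" "Pow A" character
  by (rule split_algebra_stylic)

definition diff :: "'a list \<Rightarrow> 'a list \<Rightarrow> ('a set \<Rightarrow> 'a set) \<Rightarrow> 'k" where
  "diff u v = (\<lambda>m. single (\<mu> u) m - single (\<mu> v) m)"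

abbreviation word :: "'a list \<Rightarrow> ('a set \<Rightarrow> 'a set) \<Rightarrow> 'k" where
  "word w \<equiv> single (\<mu> w)"

lemma diff_eq: "u \<in> lists A \<Longrightarrow> v \<in> lists A \<Longrightarrow> diff u v = word u \<ominus>\<^bsub>R\<^esub> word v"
  by (simp add: diff_def M.minus_apply)

lemma word_mult: "u \<in> lists A \<Longrightarrow> v \<in> lists A \<Longrightarrow> word u \<otimes>\<^bsub>R\<^esub> word v = word (u @ v)"
  by (simp add: M.single_mult Styl_mult)

lemma diff_left:
  assumes "w \<in> lists A" "u \<in> lists A" "v \<in> lists A"
  shows "word w \<otimes>\<^bsub>R\<^esub> diff u v = diff (w @ u) (w @ v)"
  using assms by (simp add: diff_eq a_minus_def alg.r_distr alg.r_minus word_mult)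

lemma diff_right:
  assumes "w \<in> lists A" "u \<in> lists A" "v \<in> lists A"
  shows "diff u v \<otimes>\<^bsub>R\<^esub> word w = diff (u @ w) (v @ w)"
  using assms by (simp add: diff_eq a_minus_def alg.l_distr alg.l_minus word_mult)

lemma character_word: "w \<in> lists A \<Longrightarrow> character B (word w) = (if set w \<subseteq> B then 1 else 0)"
  by (simp add: character_def content_stylic_map)

lemma diff_in_N: "u \<in> lists A \<Longrightarrow> v \<in> lists A \<Longrightarrow> set u = set v \<Longrightarrow> diff u v \<in> alg.N"
  by (auto simp: alg.N_def diff_eq character_word)

lemma diff_eq_zero: "\<mu> u = \<mu> v \<Longrightarrow> diff u v = \<zero>\<^bsub>R\<^esub>"
  by (simp add: diff_def M.zero_apply)

lemma diff_trans: "diff u w = diff u v \<oplus>\<^bsub>R\<^esub> diff v w"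
  by (simp add: diff_def M.add_apply)

lemma diff_sym: "u \<in> lists A \<Longrightarrow> v \<in> lists A \<Longrightarrow> diff v u = scal (Styl A) (- 1) \<otimes>\<^bsub>R\<^esub> diff u v"
proof -
  assume "u \<in> lists A" "v \<in> lists A"
  then have "diff u v \<in> carrier R" by (simp add: diff_eq)
  then show ?thesis by (simp add: M.scal_mult) (simp add: diff_def)
qed

lemma stylic_map_idem: "\<mu> (a # a # w) = \<mu> (a # w)" if "a \<in> A" "w \<in> lists A"
  using that by (intro stylic_map_eqI) (simp add: left_act_idem finite_act)

lemma stylic_map_knuth1: "\<mu> [x, z, y] = \<mu> [z, x, y]" if "x \<le> y" "y < z"
  by (rule stylic_map_eqI) (simp add: left_act_knuth1[OF finite_subset[OF _ A] that])

lemma stylic_map_knuth2: "\<mu> [y, x, z] = \<mu> [y, z, x]" if "x < y" "y \<le> z"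
  by (rule stylic_map_eqI) (simp add: left_act_knuth2[OF finite_subset[OF _ A] that])

text \<open>
  Moebius inversion: the characters give the sums of coefficients over all elements with content
  contained in \<open>B\<close>, which determine the sums over elements with content equal to \<open>B\<close>.
\<close>
lemma content_fibre_sum:
  assumes n: "n \<in> alg.N" and B: "B \<subseteq> A"
  shows "(\<Sum>x | x \<in> carrier (Styl A) \<and> content x = B. n x) = 0"
proof -
  have "finite B" using B A by (rule finite_subset)
  then show ?thesis using B
  proof (induction B rule: finite_psubset_induct)
    case (psubset B)
    let ?c = "\<lambda>C. \<Sum>x | x \<in> carrier (Styl A) \<and> content x = C. n x"
    have "0 = character B n" using n psubset.prems by (simp add: alg.N_def)
    also have "\<dots> = (\<Sum>x | x \<in> carrier (Styl A) \<and> content x \<subseteq> B. n x)"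
      unfolding character_def M.lin_def using finite_Styl
      by (intro sum.mono_neutral_cong_right) auto
    also have "\<dots> = (\<Sum>C\<in>Pow B. \<Sum>x | x \<in> {x. x \<in> carrier (Styl A) \<and> content x \<subseteq> B} \<and> content x = C. n x)"
      using finite_Styl psubset.hyps by (intro sum.group[symmetric]) auto
    also have "\<dots> = (\<Sum>C\<in>Pow B. ?c C)"
      by (intro sum.cong refl) auto
    also have "\<dots> = ?c B + (\<Sum>C\<in>Pow B - {B}. ?c C)"
      using psubset.hyps by (subst sum.remove[of _ B]) auto
    also have "(\<Sum>C\<in>Pow B - {B}. ?c C) = 0"
      using psubset by (intro sum.neutral) auto
    finally show ?case by simp
  qed
qed

text \<open>
  Modulo an ideal containing the commutators of letters, every word can be sorted and freed of
  repetitions, so it is congruent to the increasing word on its letters. By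
  \<open>content_fibre_sum\<close>, an element of \<open>N\<close> is a combination of differences between monoid elements
  and these normal forms.
\<close>
lemma N_generated:
  assumes zero: "\<zero>\<^bsub>R\<^esub> \<in> J" and add: "\<And>x y. x \<in> J \<Longrightarrow> y \<in> J \<Longrightarrow> x \<oplus>\<^bsub>R\<^esub> y \<in> J"
    and emb: "\<And>c x. x \<in> J \<Longrightarrow> scal (Styl A) c \<otimes>\<^bsub>R\<^esub> x \<in> J"
    and left: "\<And>r x. r \<in> carrier R \<Longrightarrow> x \<in> J \<Longrightarrow> r \<otimes>\<^bsub>R\<^esub> x \<in> J"
    and right: "\<And>r x. r \<in> carrier R \<Longrightarrow> x \<in> J \<Longrightarrow> x \<otimes>\<^bsub>R\<^esub> r \<in> J"
    and commutators: "\<And>a b. a \<in> A \<Longrightarrow> b \<in> A \<Longrightarrow> diff [a, b] [b, a] \<in> J"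
  shows "alg.N \<subseteq> J"
proof
  fix n assume n: "n \<in> alg.N"
  define rel where "rel u v \<longleftrightarrow> u \<in> lists A \<and> v \<in> lists A \<and> diff u v \<in> J" for u v
  have refl: "rel u u" if "u \<in> lists A" for u using that zero by (simp add: rel_def diff_eq_zero)
  have sym: "rel v u" if "rel u v" for u v using that emb[of "diff u v" "- 1"] diff_sym[of u v] by (simp add: rel_def)
  have trans [trans]: "rel u w" if "rel u v" "rel v w" for u v w
    using that add[of "diff u v" "diff v w"] diff_trans[of u w v] by (simp add: rel_def)
  have surround: "rel (p @ u @ q) (p @ v @ q)" if "rel u v" "p \<in> lists A" "q \<in> lists A" for u v p q
    using that left[of "word p" "diff (u @ q) (v @ q)"] right[of "word q" "diff u v"]
    by (simp add: rel_def diff_left diff_right)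
  have cons: "rel (a # u) (a # v)" if "rel u v" "a \<in> A" for a u v
    using surround[of u v "[a]" "[]"] that by simp
  have swap: "rel (a # b # w) (b # a # w)" if "a \<in> A" "b \<in> A" "w \<in> lists A" for a b w
    using surround[of "[a, b]" "[b, a]" "[]" w] commutators that by (simp add: rel_def)
  have ins: "rel (a # l) (insort a l)" if "l \<in> lists A" "a \<in> A" for a l
    using that(1)
  proof (induction l)
    case (Cons b l)
    have "rel (a # b # l) (b # a # l)" using Cons that by (intro swap) auto
    also have "rel (b # a # l) (b # insort a l)" using Cons by (intro cons) auto
    finally show ?case using refl[of "a # b # l"] Cons that by simp
  qed (use refl that in simp)
  have sorted: "rel w (sorted_list_of_set (set w))" if "w \<in> lists A" for w
    using that
  proof (induction w)
    case Nil
    then show ?case using refl by simp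
  next
    case (Cons a w)
    let ?S = "sorted_list_of_set (set w)" and ?T = "sorted_list_of_set (set w - {a})"
    have a: "a \<in> A" and w: "w \<in> lists A" using Cons by auto
    have ST: "?S \<in> lists A" "?T \<in> lists A" using w by auto
    have 1: "rel (a # w) (a # ?S)" using Cons by (intro cons) auto
    show ?case
    proof (cases "a \<in> set w")
      case False
      then have "insort a ?S = sorted_list_of_set (set (a # w))"
        by (simp add: sorted_list_of_set_insert_remove)
      then show ?thesis using trans[OF 1 ins[OF ST(1) a]] by simp
    next
      case True
      then have S: "insort a ?T = ?S"
        using sorted_list_of_set_insert_remove[of "set w" a] by (simp add: insert_absorb)
      \<comment> \<open>a repeated letter is moved next to its other occurrence and absorbed\<close>
      have aT: "rel (a # ?T) ?S" using ins[OF ST(2) a] S by simp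
      then have "rel (a # ?S) (a # a # ?T)" using sym cons a by blast
      then have "rel (a # ?S) (a # ?T)"
        using a ST stylic_map_idem[OF a ST(2)] by (simp add: rel_def diff_def)
      then show ?thesis using trans[OF 1 trans[OF _ aT]] True by (simp add: insert_absorb)
    qed
  qed
  define can where "can x = \<mu> (sorted_list_of_set (content x))" for x
  have step: "(\<lambda>m. c * (single x m - single (can x) m)) \<in> J" if x: "x \<in> carrier (Styl A)" for x c
  proof -
    obtain w where w: "w \<in> lists A" "x = \<mu> w" using x by (rule Styl_cases)
    have "diff w (sorted_list_of_set (set w)) \<in> J" using sorted[OF w(1)] by (simp add: rel_def)
    moreover have "sorted_list_of_set (set w) \<in> lists A" using w(1) by auto
    then have "diff w (sorted_list_of_set (set w)) \<in> carrier R" using w(1) by (simp add: diff_eq)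
    ultimately have "(\<lambda>m. c * diff w (sorted_list_of_set (set w)) m) \<in> J"
      using emb[of "diff w (sorted_list_of_set (set w))" c] by (simp add: M.scal_mult)
    then show ?thesis using w by (simp add: diff_def can_def content_stylic_map)
  qed
  have sum: "(\<lambda>m. \<Sum>x\<in>T. n x * (single x m - single (can x) m)) \<in> J" if "finite T" "T \<subseteq> carrier (Styl A)" for T
    using that
  proof (induction T rule: finite_induct)
    case empty
    then show ?case using zero by (simp add: M.zero_apply)
  next
    case (insert x T)
    then have "(\<lambda>m. n x * (single x m - single (can x) m)) \<oplus>\<^bsub>R\<^esub> (\<lambda>m. \<Sum>x\<in>T. n x * (single x m - single (can x) m)) \<in> J"
      using step by (intro add) auto
    then show ?case using insert by (simp add: M.add_apply)
  qed
  have "(\<Sum>x\<in>carrier (Styl A). n x * (single x m - single (can x) m)) = n m" for m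
  proof -
    have "(\<Sum>x\<in>carrier (Styl A). n x * single x m) = n m"
      using alg.N_closed[OF n] finite_Styl
      by (auto simp: single_def M.carrier_iff if_distrib[of "\<lambda>x. _ * x"] cong: if_cong)
    moreover have "(\<Sum>x\<in>carrier (Styl A). n x * single (can x) m) = 0"
    proof -
      have "(\<Sum>x\<in>carrier (Styl A). n x * single (can x) m)
          = (\<Sum>B\<in>Pow A. \<Sum>x | x \<in> carrier (Styl A) \<and> content x = B. n x * single (can x) m)"
        using finite_Styl A by (intro sum.group[symmetric]) (auto simp: content_def)
      also have "\<dots> = (\<Sum>B\<in>Pow A. (\<Sum>x | x \<in> carrier (Styl A) \<and> content x = B. n x) *
          single (\<mu> (sorted_list_of_set B)) m)"
        unfolding sum_distrib_right by (intro sum.cong refl) (auto simp: can_def)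
      also have "\<dots> = 0" using content_fibre_sum[OF n] by (intro sum.neutral) auto
      finally show ?thesis .
    qed
    ultimately show ?thesis by (simp add: right_diff_distrib sum_subtractf)
  qed
  then show "n \<in> J" using sum[OF finite_Styl order_refl] by simp
qed

section \<open>Arrows between two columns\<close>

text \<open>
  \<open>C\<close> arises from \<open>B\<close> by the frank right action of \<open>z\<close>, which replaces \<open>x\<close>
  (\<open>frank_iff_slide\<close>).
\<close>
definition slide :: "'a set \<Rightarrow> 'a set \<Rightarrow> 'a \<Rightarrow> 'a \<Rightarrow> bool" where
  "slide B C x z \<longleftrightarrow> x \<in> B \<and> z \<in> A \<and> z \<notin> B \<and> x < z \<and> B \<inter> {x<..<z} = {} \<and> C = insert z (B - {x})"

context
  fixes e f B C assumes e: "alg.weight e B" and f: "alg.weight f C"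
begin

abbreviation com :: "'a \<Rightarrow> 'a \<Rightarrow> ('a set \<Rightarrow> 'a set) \<Rightarrow> 'k" where
  "com a b \<equiv> diff [a, b] [b, a]"

abbreviation Z :: "(('a set \<Rightarrow> 'a set) \<Rightarrow> 'k) set" where
  "Z \<equiv> alg.multiples e f \<zero>\<^bsub>R\<^esub>"

lemmas Z = alg.multiples_zero[OF e f alg.N_zero] alg.multiples_add[OF e f alg.N_zero]
  alg.multiples_emb[OF e f alg.N_zero]
lemmas Z_left = alg.multiples_left[OF e f alg.N_zero]
lemmas Z_right = alg.multiples_right[OF e f alg.N_zero]
lemmas Z_left_zero = alg.multiples_left_zero[OF e f alg.N_zero]
lemmas Z_right_zero = alg.multiples_right_zero[OF e f alg.N_zero]
lemmas Z_left_cancel = alg.multiples_left_cancel[OF e f alg.N_zero]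
lemmas Z_right_cancel = alg.multiples_right_cancel[OF e f alg.N_zero]

lemma BC: "B \<subseteq> A" "C \<subseteq> A"
  using e f unfolding alg.weight_def by blast+

lemma com_N: "a \<in> A \<Longrightarrow> b \<in> A \<Longrightarrow> com a b \<in> alg.N"
  by (rule diff_in_N) auto

lemma com_swap: "a \<in> A \<Longrightarrow> b \<in> A \<Longrightarrow> com a b \<in> Z \<Longrightarrow> com b a \<in> Z"
  using Z(3)[of "com a b" "- 1"] diff_sym[of "[a, b]" "[b, a]"] by simp

text \<open>
  From \<open>a\<^sup>2 = a\<close> one gets \<open>[a, b] = a [a, b] + [a, b] a\<close>, and \<open>a\<close> acts as zero on both sides.
\<close>
lemma com_outside:
  assumes "a \<in> A" "b \<in> A" "a \<notin> B" "a \<notin> C"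
  shows "com a b \<in> Z"
proof -
  have "\<mu> [b, a, a] = \<mu> [b, a]"
    using Styl_mult[of "[a, a]" "[b]"] Styl_mult[of "[a]" "[b]"] stylic_map_idem[of a "[]"] assms by simp
  then have "com a b = word [a] \<otimes>\<^bsub>R\<^esub> com a b \<oplus>\<^bsub>R\<^esub> com a b \<otimes>\<^bsub>R\<^esub> word [a]"
    using assms stylic_map_idem[of a "[b]"]
    by (simp add: diff_left diff_right) (simp add: diff_def M.add_apply)
  moreover have "word [a] \<otimes>\<^bsub>R\<^esub> com a b \<in> Z"
    using assms by (intro Z_left_zero com_N) (simp_all add: character_word)
  moreover have "com a b \<otimes>\<^bsub>R\<^esub> word [a] \<in> Z"
    using assms by (intro Z_right_zero com_N) (simp_all add: character_word)
  ultimately show ?thesis using Z(2) by metis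
qed

text \<open>The Knuth relation \<open>x z y = z x y\<close> reads \<open>[x, z] y = 0\<close>, and \<open>y\<close> acts from the right as \<open>1\<close>.\<close>
lemma com_knuth1:
  assumes "x \<in> A" "z \<in> A" "y \<in> C" "x \<le> y" "y < z"
  shows "com x z \<in> Z"
proof (rule Z_right_cancel)
  have y: "y \<in> A" using assms BC by auto
  have "com x z \<otimes>\<^bsub>R\<^esub> word [y] = \<zero>\<^bsub>R\<^esub>"
    using assms y stylic_map_knuth1[of x y z] by (simp add: diff_right diff_eq_zero)
  then show "com x z \<otimes>\<^bsub>R\<^esub> word [y] \<in> Z" using Z(1) by simp
qed (use assms BC in \<open>auto simp: character_word com_N\<close>)

text \<open>The Knuth relation \<open>y x z = y z x\<close> reads \<open>y [x, z] = 0\<close>, and \<open>y\<close> acts from the left as \<open>1\<close>.\<close>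
lemma com_knuth2:
  assumes "x \<in> A" "z \<in> A" "y \<in> B" "x < y" "y \<le> z"
  shows "com x z \<in> Z"
proof (rule Z_left_cancel)
  have y: "y \<in> A" using assms BC by auto
  have "word [y] \<otimes>\<^bsub>R\<^esub> com x z = \<zero>\<^bsub>R\<^esub>"
    using assms y stylic_map_knuth2[of x y z] by (simp add: diff_left diff_eq_zero)
  then show "word [y] \<otimes>\<^bsub>R\<^esub> com x z \<in> Z" using Z(1) by simp
qed (use assms BC in \<open>auto simp: character_word com_N\<close>)

text \<open>
  By the Jacobi identity \<open>[y, [x, z]] = [[y, x], z] + [x, [y, z]]\<close>, the left and right actions of
  \<open>y\<close> on \<open>[x, z]\<close> agree in the corner; but one of them is \<open>1\<close> and the other \<open>0\<close>.
\<close>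
lemma com_jacobi:
  assumes A3: "x \<in> A" "y \<in> A" "z \<in> A" and "com y x \<in> Z" "com y z \<in> Z" and y: "y \<in> B \<longleftrightarrow> y \<notin> C"
  shows "com x z \<in> Z"
proof -
  have n: "com x z \<in> alg.N" using A3 by (intro com_N)
  let ?neg = "\<lambda>r. scal (Styl A) (- 1) \<otimes>\<^bsub>R\<^esub> r"
  have neg: "?neg (diff u v) = diff v u" if "u \<in> lists A" "v \<in> lists A" for u v
    using diff_sym[OF that] by simp
  \<comment> \<open>the element \<open>[[y, x], z] + [x, [y, z]]\<close>\<close>
  define s where "s = com y x \<otimes>\<^bsub>R\<^esub> word [z] \<oplus>\<^bsub>R\<^esub> (?neg (word [z] \<otimes>\<^bsub>R\<^esub> com y x) \<oplus>\<^bsub>R\<^esub>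
    (word [x] \<otimes>\<^bsub>R\<^esub> com y z \<oplus>\<^bsub>R\<^esub> ?neg (com y z \<otimes>\<^bsub>R\<^esub> word [x])))"
  have s: "s \<in> Z" unfolding s_def using assms by (intro Z Z_left Z_right) auto
  have left: "word [y] \<otimes>\<^bsub>R\<^esub> com x z = s \<oplus>\<^bsub>R\<^esub> com x z \<otimes>\<^bsub>R\<^esub> word [y]"
    and right: "com x z \<otimes>\<^bsub>R\<^esub> word [y] = ?neg s \<oplus>\<^bsub>R\<^esub> word [y] \<otimes>\<^bsub>R\<^esub> com x z"
  proof -
    have s_eq: "s = (\<lambda>m. word [y, x, z] m - word [y, z, x] m - word [x, z, y] m + word [z, x, y] m)"
      using A3 by (simp add: s_def diff_left diff_right neg) (simp add: diff_def M.add_apply algebra_simps)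
    show "word [y] \<otimes>\<^bsub>R\<^esub> com x z = s \<oplus>\<^bsub>R\<^esub> com x z \<otimes>\<^bsub>R\<^esub> word [y]"
      using A3 by (simp add: s_eq diff_left diff_right) (simp add: diff_def M.add_apply)
    have "s \<in> carrier R" using s alg.N_closed by (auto simp: alg.multiples_def[OF e f])
    then show "com x z \<otimes>\<^bsub>R\<^esub> word [y] = ?neg s \<oplus>\<^bsub>R\<^esub> word [y] \<otimes>\<^bsub>R\<^esub> com x z"
      using A3 by (simp add: diff_left diff_right M.scal_mult) (simp add: s_eq diff_def M.add_apply)
  qed
  show ?thesis
  proof (cases "y \<in> B")
    case True
    have "com x z \<otimes>\<^bsub>R\<^esub> word [y] \<in> Z" using True y A3 n by (intro Z_right_zero) (auto simp: character_word)
    then have "word [y] \<otimes>\<^bsub>R\<^esub> com x z \<in> Z" unfolding left using s by (intro Z)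
    then show ?thesis by (rule Z_left_cancel) (use True A3 n in \<open>auto simp: character_word\<close>)
  next
    case False
    have "word [y] \<otimes>\<^bsub>R\<^esub> com x z \<in> Z" using False y A3 n by (intro Z_left_zero) (auto simp: character_word)
    then have "com x z \<otimes>\<^bsub>R\<^esub> word [y] \<in> Z" unfolding right using s by (intro Z)
    then show ?thesis by (rule Z_right_cancel) (use False y A3 n in \<open>auto simp: character_word\<close>)
  qed
qed

text \<open>
  The Knuth relations with \<open>y = x\<close>, \<open>y = z\<close> and \<open>x < y < z\<close>, together with \<open>com_outside\<close>,
  leave only \<open>x \<in> B - C\<close> and \<open>z \<in> C - B\<close> with nothing of \<open>B\<close> or \<open>C\<close> in between. A further
  element \<open>y\<close> in exactly one of \<open>B\<close> and \<open>C\<close> lies outside the interval from \<open>x\<close> to \<open>z\<close>; then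
  \<open>[y, x]\<close> and \<open>[y, z]\<close> die by Knuth relations, and \<open>com_jacobi\<close> applies.
\<close>
lemma com_in_Z:
  assumes xz: "x \<in> A" "z \<in> A" "x < z" and nslide: "\<not> slide B C x z"
  shows "com x z \<in> Z"
proof (rule ccontr)
  assume contra: "com x z \<notin> Z"
  have xC: "x \<notin> C" using com_knuth1[of x z x] xz contra by auto
  have zB: "z \<notin> B" using com_knuth2[of x z z] xz contra by auto
  have xB: "x \<in> B" using com_outside[of x z] xz xC contra by auto
  have zC: "z \<in> C" using com_outside[of z x] com_swap[of z x] xz zB contra by auto
  have gap: "y \<notin> B" "y \<notin> C" if "x < y" "y < z" for y
    using com_knuth1[of x z y] com_knuth2[of x z y] xz contra that by (auto simp: less_imp_le)
  have "y \<in> B \<longleftrightarrow> y \<in> C" if y: "y \<noteq> x" "y \<noteq> z" for y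
  proof (rule ccontr)
    assume yBC: "\<not> (y \<in> B \<longleftrightarrow> y \<in> C)"
    then have yA: "y \<in> A" using BC by auto
    have "\<not> (x < y \<and> y < z)" using gap yBC by auto
    then consider "y < x" | "z < y" using y by force
    then have "com y x \<in> Z \<and> com y z \<in> Z"
    proof cases
      case 1
      then show ?thesis using com_knuth2[of y x x] com_knuth2[of y z x] xz xB yA by auto
    next
      case 2
      then have "com x y \<in> Z" "com z y \<in> Z" using com_knuth1[of x y z] com_knuth1[of z y z] xz zC yA by auto
      then show ?thesis using com_swap xz yA by blast
    qed
    then show False using com_jacobi[of x y z] xz yA yBC contra by blast
  qed
  then have "y \<in> C \<longleftrightarrow> y \<in> insert z (B - {x})" for y using xC zC by (cases "y = x"; cases "y = z") auto
  then have "C = insert z (B - {x})" by blast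
  moreover have "B \<inter> {x<..<z} = {}" using gap by auto
  ultimately show False using nslide xz xB zB by (simp add: slide_def)
qed

lemma arrow_space_dim_no_slide:
  assumes "\<And>x z. \<not> slide B C x z"
  shows "ring.dimension (R Quot radical_square R) 0 (quotient_scalars (range (scal (Styl A))) R) (arrow_space R e f)"
proof (rule alg.arrow_space_dim_0[OF e f], rule N_generated)
  show "com a b \<in> Z" if "a \<in> A" "b \<in> A" for a b
  proof -
    consider "a < b" | "a = b" | "b < a" by force
    then show ?thesis
    proof cases
      case 2
      then show ?thesis using Z(1) by (simp add: diff_eq_zero)
    qed (use that assms com_in_Z com_swap in blast)+
  qed
qed (use Z Z_left Z_right in auto)

text \<open>
  All commutators other than \<open>\<plusminus>[x, z]\<close> die, so the space is at most a line, and the derivation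
  \<open>crossing B x z\<close> takes the value \<open>1 - 0\<close> on \<open>[x, z]\<close>.
\<close>
lemma arrow_space_dim_slide:
  assumes xz: "slide B C x z"
  shows "ring.dimension (R Quot radical_square R) 1 (quotient_scalars (range (scal (Styl A))) R) (arrow_space R e f)"
proof -
  have C: "C = insert z (B - {x})" and BAx: "x \<in> B" "z \<in> A" "z \<notin> B" "x < z" "B \<inter> {x<..<z} = {}"
    using xz by (auto simp: slide_def)
  have xA: "x \<in> A" using BAx BC by auto
  have n0: "com x z \<in> alg.N" using xA BAx by (intro com_N)
  note J = alg.multiples_zero[OF e f n0] alg.multiples_add[OF e f n0] alg.multiples_emb[OF e f n0]
    alg.multiples_left[OF e f n0] alg.multiples_right[OF e f n0]
  have up: "com a b \<in> alg.multiples e f (com x z)" if "a \<in> A" "b \<in> A" "a < b" for a b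
  proof (cases "slide B C a b")
    case True
    then have "B - C = {a}" "C - B = {b}" by (auto simp: slide_def)
    moreover have "B - C = {x}" "C - B = {z}" using C BAx by auto
    ultimately have "a = x" "b = z" by auto
    then show ?thesis using alg.multiples_self[OF e f n0] by simp
  next
    case False
    then show ?thesis using com_in_Z[OF that] alg.multiples_zero_subset[OF e f n0] by blast
  qed
  have "alg.N \<subseteq> alg.multiples e f (com x z)"
  proof (rule N_generated)
    show "com a b \<in> alg.multiples e f (com x z)" if "a \<in> A" "b \<in> A" for a b
    proof -
      consider "a < b" | "a = b" | "b < a" by force
      then show ?thesis
      proof cases
        case 2
        then show ?thesis using J(1) by (simp add: diff_eq_zero)
      next
        case 3
        then show ?thesis using J(3)[OF up[OF that(2,1)], of "- 1"] that diff_sym[of "[b, a]" "[a, b]"] by simp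
      qed (use up that in blast)
    qed
  qed (use J in auto)
  moreover have "alg.corner e f (com x z) \<noteq> alg.corner e f \<zero>\<^bsub>R\<^esub>"
  proof (rule alg.corner_not_zero[OF e f _ _ n0])
    let ?d = "M.lin (crossing B x z) :: (('a set \<Rightarrow> 'a set) \<Rightarrow> 'k) \<Rightarrow> 'k"
    show "?d (g \<oplus>\<^bsub>R\<^esub> h) = ?d g + ?d h" for g h by (rule M.lin_add)
    show "?d (g \<otimes>\<^bsub>R\<^esub> h) = character B g * ?d h + ?d g * character C h"
      if "g \<in> carrier R" "h \<in> carrier R" for g h
    proof -
      have "?d (g \<otimes>\<^bsub>R\<^esub> h) = (\<Sum>m\<in>carrier (Styl A). \<Sum>m'\<in>carrier (Styl A).
          (g m * (if content m \<subseteq> B then 1 else 0)) * (h m' * crossing B x z m') +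
          (g m * crossing B x z m) * (h m' * (if content m' \<subseteq> C then 1 else 0)))"
        unfolding M.lin_mult[OF that]
        by (intro sum.cong refl) (simp add: crossing_mult[OF _ _ BAx] C algebra_simps)
      also have "\<dots> = character B g * ?d h + ?d g * character C h"
        unfolding character_def M.lin_def sum_product by (simp add: sum.distrib)
      finally show ?thesis .
    qed
    have "?d (com x z) = crossing B x z (\<mu> [x, z]) - crossing B x z (\<mu> [z, x])"
      using xA BAx M.lin_single[of "\<mu> [x, z]" "crossing B x z :: _ \<Rightarrow> 'k"]
        M.lin_single[of "\<mu> [z, x]" "crossing B x z :: _ \<Rightarrow> 'k"]
      by (simp add: diff_def M.lin_def left_diff_distrib sum_subtractf)
    also have "\<dots> = 1" using xA BAx by (auto simp: crossing_stylic_map[OF _ BAx])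
    finally show "?d (com x z) \<noteq> 0" by simp
  qed
  ultimately show ?thesis by (rule alg.arrow_space_dim_1[OF e f n0])
qed

end

section \<open>The quiver of the stylic algebra\<close>

lemma frank_iff_slide:
  assumes "B \<subseteq> A"
  shows "c \<in> A \<and> frank B c \<and> right_act B c = C \<longleftrightarrow> (\<exists>x. slide B C x c)"
proof
  have fin: "finite B" using assms A by (rule finite_subset)
  {
    assume *: "c \<in> A \<and> frank B c \<and> right_act B c = C"
    let ?S = "{x \<in> B. x \<le> c}"
    have "Min B \<in> ?S" using * fin by (simp add: frank_def)
    then have b: "Max ?S \<in> ?S" "\<And>y. y \<in> ?S \<Longrightarrow> y \<le> Max ?S"
    proof -
      have S: "finite ?S" "?S \<noteq> {}" using fin \<open>Min B \<in> ?S\<close> by auto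
      show "Max ?S \<in> ?S" using S by (rule Max_in)
      show "y \<le> Max ?S" if "y \<in> ?S" for y using S(1) that by (rule Max_ge)
    qed
    have not_all_greater: "\<not> (\<forall>x\<in>B. c < x)" using b(1) by force
    have "right_act B c = insert c (B - {Max ?S})"
      by (simp only: right_act_def not_all_greater if_False) simp
    then have "C = insert c (B - {Max ?S})" using * by simp
    moreover have "Max ?S < c" using b(1) * by (auto simp: frank_def order_le_less)
    moreover have "B \<inter> {Max ?S<..<c} = {}" using b(2) by force
    ultimately show "\<exists>x. slide B C x c" using b(1) * by (auto simp: slide_def frank_def)
  }
  assume "\<exists>x. slide B C x c"
  then obtain x where x: "x \<in> B" "c \<in> A" "c \<notin> B" "x < c" "B \<inter> {x<..<c} = {}" "C = insert c (B - {x})"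
    by (auto simp: slide_def)
  have "Max {y \<in> B. y \<le> c} = x"
    using x fin by (intro Max_eqI) (force simp: order_le_less)+
  moreover have "Min B \<le> c" using x fin by (meson Min_le less_imp_le order_trans)
  ultimately show "c \<in> A \<and> frank B c \<and> right_act B c = C"
    using x by (auto simp: right_act_def frank_def not_less intro: less_imp_le)
qed

theorem stylic_quiver: "is_gabriel_quiver (range (scal (Styl A))) R (column_quiver A)"
proof (rule alg.gabriel_quiverI)
  let ?Q = "column_quiver A"
  show "ring.finite_dimension R (range (scal (Styl A))) (carrier R)"
    by (rule M.finite_dimension_monoid_algebra)
  show "verts ?Q = Pow A" by (simp add: column_quiver_def columns_def)
  show "fin_digraph ?Q"
  proof
    show "finite (verts ?Q)" using A by (simp add: column_quiver_def columns_def)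
    have "arcs ?Q \<subseteq> Pow A \<times> A" by (auto simp: column_quiver_def columns_def)
    then show "finite (arcs ?Q)" using A by (meson finite_Pow_iff finite_SigmaI finite_subset)
    fix a assume "a \<in> arcs ?Q"
    then show "tail ?Q a \<in> verts ?Q" "head ?Q a \<in> verts ?Q"
      by (auto simp: column_quiver_def columns_def right_act_def split: if_splits)
  qed
  fix e f B C assume e: "alg.weight e B" and f: "alg.weight f C"
  then have "B \<subseteq> A" unfolding alg.weight_def by blast
  then have "{a \<in> arcs ?Q. tail ?Q a = B \<and> head ?Q a = C} = Pair B ` {c. c \<in> A \<and> frank B c \<and> right_act B c = C}"
    by (auto simp: column_quiver_def columns_def)
  then have arcs: "{a \<in> arcs ?Q. tail ?Q a = B \<and> head ?Q a = C} = Pair B ` {c. \<exists>x. slide B C x c}"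
    unfolding frank_iff_slide[OF \<open>B \<subseteq> A\<close>] .
  show "ring.dimension (R Quot radical_square R) (card {a \<in> arcs ?Q. tail ?Q a = B \<and> head ?Q a = C})
     (quotient_scalars (range (scal (Styl A))) R) (arrow_space R e f)"
  proof (cases "\<exists>x z. slide B C x z")
    case True
    then obtain x z where xz: "slide B C x z" by blast
    have "{c. \<exists>x. slide B C x c} = {z}"
    proof -
      have "c = z" if "slide B C y c" for y c
      proof -
        have "C - B = {c}" "C - B = {z}" using xz that by (auto simp: slide_def)
        then show ?thesis by simp
      qed
      then show ?thesis using xz by blast
    qed
    then show ?thesis using arrow_space_dim_slide[OF e f xz] unfolding arcs by simp
  next
    case False
    then have "{c. \<exists>x. slide B C x c} = {}" by blast
    then show ?thesis using arrow_space_dim_no_slide[OF e f] False unfolding arcs by simp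
  qed
qed

end

theorem theorem4p15:
  fixes A :: "'a::linorder set"
  assumes "finite A"
  shows "is_gabriel_quiver
           (scalars (Styl A) :: (('a set \<Rightarrow> 'a set) \<Rightarrow> 'k::field_char_0) set)
           (monoid_algebra (Styl A))
           (column_quiver A)"
proof -
  interpret stylic_algebra A "TYPE('k)" by unfold_locales (rule assms)
  show ?thesis unfolding scalars_eq by (rule stylic_quiver)
qed

end
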